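(* Consider the following evolution model. Let $X$ and $Z$ be positive integer-valued random variables; let $(X_n)_{n\ge 0}$ be i.i.d.\ copies of $X$, $(Z_n)_{n\ge 0}$ i.i.d.\ copies of $Z$, all mutually independent. Fix $p\in(0,1)$ and set $q=1-p$. The state at time $n$ is a finite set $T_n$ of vertices, each carrying a fitness in $[0,1]$, with $T_0=\emptyset$. At each time $n$, independently of everything else: with probability $p$, $Z_n$ new vertices are added, each with a fitness uniformly distributed on $[0,1]$ independently of each other and of everything else (so $|T_{n+1}|=|T_n|+Z_n$); otherwise (with probability $q$) the $X_n$ vertices with the smallest fitnesses are removed, and if $T_n$ has fewer than $X_n$ vertices all are removed (so $|T_{n+1}|=\max\{|T_n|-X_n,0\}$). Let $\mu_X=\mathbb{E}X$, $\mu_Z=\mathbb{E}Z$ (possibly infinite), and when both are finite let $p_c=\frac{\mu_X}{\mu_X+\mu_Z}$. Then: (a) If $\mu_Z=\infty$ and $\mu_X<\infty$, then $T_n$ (as a set of fitnesses) approaches a random sample from $U[0,1]$. (b) If $\mu_Z<\infty$, $\mu_X<\infty$ and $p>p_c$, then $T_n$ approaches a random sample from $U[f,1]$, where $f=\frac{q}{p}\frac{\mu_X}{\mu_Z}$. (c) If $\mu_Z<\infty$ and either ($\mu_X<\infty$ and $p<p_c$) or $\mu_X=\infty$, then almost surely $T_n=\emptyset$ for infinitely many $n$.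
   Context: Definition: Suppose $A_1\subseteq A_2\subseteq\cdots$ is an infinite sequence of sets, each a finite collection of points in $\mathbb{R}$. We say $A_n$ approaches a random sample from distribution $F$ if, with probability $1$, there exists another sequence of sets $B_1\subseteq B_2\subseteq\cdots$ such that (i) each $B_n$ is a finite collection of i.i.d.\ random variables with common distribution $F$; (ii) $|B_n|\to\infty$ as $n\to\infty$; (iii) $|A_n\,\Delta\, B_n|=o(|B_n|)$ as $n\to\infty$, where $A\Delta B=(A\setminus B)\cup(B\setminus A)$. $U[a,b]$ denotes the uniform distribution on $[a,b]$.
   Formalization: The definition of "approaches a random sample" asks for nested sets A_1 ⊆ A_2 ⊆ …, but T_n is not nested since vertices get removed; nesting is required only of the B_n, taken as prefixes of random length of one i.i.d. sequence. *)

theory Defs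
  imports "HOL-Probability.Probability"
begin

text \<open>Labels of vertices: (n, k) is the k-th vertex added at time n.
  The fitness of vertex (n, k) is u n k.\<close>

text \<open>The set of the m vertices of S with smallest fitness g (ties, which occur with
  probability zero, are broken lexicographically by label); all of S if card S < m.\<close>
definition lowest :: "nat \<Rightarrow> (nat \<times> nat \<Rightarrow> real) \<Rightarrow> (nat \<times> nat) set \<Rightarrow> (nat \<times> nat) set" where
  "lowest m g S = {v \<in> S. card {w \<in> S. g w < g v \<or>
        (g w = g v \<and> (fst w < fst v \<or> (fst w = fst v \<and> snd w < snd v)))} < m}"

text \<open>The vertex set T_n of the evolution model, given the realisations:
  c n = coin at time n (True = addition step), z n = Z_n, x n = X_n, u n k = fitnesses.\<close>
fun evol :: "(nat \<Rightarrow> bool) \<Rightarrow> (nat \<Rightarrow> nat) \<Rightarrow> (nat \<Rightarrow> nat) \<Rightarrow> (nat \<Rightarrow> nat \<Rightarrow> real)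
               \<Rightarrow> nat \<Rightarrow> (nat \<times> nat) set" where
  "evol c z x u 0 = {}"
| "evol c z x u (Suc n) =
     (if c n then evol c z x u n \<union> {(n, k) | k. k < z n}
      else evol c z x u n - lowest (x n) (\<lambda>v. u (fst v) (snd v)) (evol c z x u n))"

definition fitset :: "(nat \<Rightarrow> bool) \<Rightarrow> (nat \<Rightarrow> nat) \<Rightarrow> (nat \<Rightarrow> nat) \<Rightarrow> (nat \<Rightarrow> nat \<Rightarrow> real)
               \<Rightarrow> nat \<Rightarrow> real set" where
  "fitset c z x u n = (\<lambda>v. u (fst v) (snd v)) ` evol c z x u n"

definition approaches_sample :: "'a measure \<Rightarrow> (nat \<Rightarrow> 'a \<Rightarrow> real set) \<Rightarrow> real measure \<Rightarrow> bool" where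
  "approaches_sample M A F \<longleftrightarrow>
     (\<exists>(Y :: nat \<Rightarrow> 'a \<Rightarrow> real) (N :: nat \<Rightarrow> 'a \<Rightarrow> nat).
        prob_space.indep_vars M (\<lambda>_. borel) Y UNIV \<and>
        (\<forall>i. distr M borel (Y i) = F) \<and>
        (\<forall>n. N n \<in> measurable M (count_space UNIV)) \<and>
        (AE \<omega> in M.
           mono (\<lambda>n. N n \<omega>) \<and>
           filterlim (\<lambda>n. card {Y i \<omega> | i. i < N n \<omega>}) at_top sequentially \<and>
           (\<lambda>n. real (card ((A n \<omega> - {Y i \<omega> | i. i < N n \<omega>}) \<union> ({Y i \<omega> | i. i < N n \<omega>} - A n \<omega>))))
             \<in> o(\<lambda>n. real (card {Y i \<omega> | i. i < N n \<omega>}))))"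

text \<open>Index type used to express mutual independence of all driving randomness.\<close>
datatype idx = IX nat | IZ nat | IC nat | IU nat nat

definition nn_mean :: "'a measure \<Rightarrow> ('a \<Rightarrow> nat) \<Rightarrow> ennreal" where
  "nn_mean M V = (\<integral>\<^sup>+ \<omega>. ennreal (real (V \<omega>)) \<partial>M)"

end

theory Submission
  imports Defs
begin

text \<open>Fix a threshold f. Since removals always hit the lowest fitnesses, the number of vertices of
  fitness at most f evolves autonomously, as a random walk reflected at 0, so it equals an increment
  \<open>S n - S m\<close> with \<open>m \<le> n\<close> of the unreflected walk S. The value f of the theorem is the one that
  makes S driftless; by the strong law S is then o(n), hence so is the number of low survivors,
  and counting shows that only o(n) vertices above f have ever been removed. Therefore T n differs in
  o(n) points from the set of all fitnesses above f added so far. Listed in order of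
  arrival, these are i.i.d. uniform on [f, 1]: given the positions of the first k of them, their
  values are only conditioned to exceed f. If Z has infinite mean the same argument works with
  f = 0, as the total number of removals is negligible. In the subcritical case the whole population
  is a reflected walk with negative drift, which returns to 0 infinitely often.

  The strong law is deduced from the maximal ergodic inequality: if sums of i.i.d. variables are
  unbounded above with positive probability, then they are so almost surely by the 0-1 law, and the
  inequality forces the mean to be nonnegative.\<close>

section \<open>Strong law of large numbers\<close>

lemma (in prob_space) indep_vars_reindex:
  assumes "indep_vars M' X I" "inj_on h L" "h ` L \<subseteq> I"
  shows "indep_vars (\<lambda>j. M' (h j)) (\<lambda>j. X (h j)) L"
proof -
  have "indep_vars (\<lambda>j. PiM {h j} M') (\<lambda>j \<omega>. restrict (\<lambda>i. X i \<omega>) {h j}) L"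
    using assms by (intro indep_vars_restrict) (auto simp: disjoint_family_on_def inj_on_def)
  then have "indep_vars (\<lambda>j. M' (h j)) (\<lambda>j \<omega>. (\<lambda>x. x (h j)) (restrict (\<lambda>i. X i \<omega>) {h j})) L"
    by (rule indep_vars_compose2) simp
  then show ?thesis by simp
qed

lemma (in prob_space) iid_shift_distr:
  assumes ind: "indep_vars (\<lambda>_. N) X (UNIV :: nat set)"
    and id: "\<And>n. distr M N (X n) = distr M N (X 0)"
  shows "distr M (\<Pi>\<^sub>M n\<in>UNIV. N) (\<lambda>\<omega> n. X (Suc n) \<omega>) = distr M (\<Pi>\<^sub>M n\<in>UNIV. N) (\<lambda>\<omega> n. X n \<omega>)"
proof -
  have rv: "\<And>n. random_variable N (X n)"
    using ind by (auto simp: indep_vars_def2)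
  have ind': "indep_vars (\<lambda>_. N) (\<lambda>n. X (Suc n)) UNIV"
    using indep_vars_reindex[OF ind, of Suc UNIV] by auto
  have "distr M (\<Pi>\<^sub>M n\<in>UNIV. N) (\<lambda>\<omega>. \<lambda>n\<in>UNIV. X n \<omega>) = (\<Pi>\<^sub>M n\<in>UNIV. distr M N (X n))"
    using indep_vars_iff_distr_eq_PiM'[of UNIV X "\<lambda>_. N"] ind rv by auto
  moreover have "distr M (\<Pi>\<^sub>M n\<in>UNIV. N) (\<lambda>\<omega>. \<lambda>n\<in>UNIV. X (Suc n) \<omega>)
      = (\<Pi>\<^sub>M n\<in>UNIV. distr M N (X (Suc n)))"
    using indep_vars_iff_distr_eq_PiM'[of UNIV "\<lambda>n. X (Suc n)" "\<lambda>_. N"] ind' rv by auto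
  moreover have "(\<lambda>n. distr M N (X (Suc n))) = (\<lambda>n. distr M N (X n))"
    using id by (metis (no_types))
  ultimately show ?thesis by (simp add: restrict_UNIV)
qed

definition walk_max :: "nat \<Rightarrow> (nat \<Rightarrow> real) \<Rightarrow> real" where
  "walk_max n y = Max ((\<lambda>k. \<Sum>i<k. y i) ` {..n})"

lemma walk_max_ge: "k \<le> n \<Longrightarrow> (\<Sum>i<k. y i) \<le> walk_max n y"
  unfolding walk_max_def by (rule Max_ge) auto

lemma walk_max_nonneg: "0 \<le> walk_max n y"
  using walk_max_ge[of 0 n y] by simp

lemma walk_max_attained: "\<exists>k\<le>n. walk_max n y = (\<Sum>i<k. y i)"
proof -
  have "walk_max n y \<in> (\<lambda>k. \<Sum>i<k. y i) ` {..n}"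
    unfolding walk_max_def by (rule Max_in) auto
  then show ?thesis by auto
qed

lemma walk_max_pos_iff: "0 < walk_max n y \<longleftrightarrow> (\<exists>k\<le>n. 0 < (\<Sum>i<k. y i))"
  by (metis walk_max_attained walk_max_ge less_le_trans)

lemma walk_max_le_sum_abs: "walk_max n y \<le> (\<Sum>i<n. \<bar>y i\<bar>)"
proof -
  obtain k where k: "k \<le> n" "walk_max n y = (\<Sum>i<k. y i)"
    using walk_max_attained by blast
  have "(\<Sum>i<k. y i) \<le> (\<Sum>i<k. \<bar>y i\<bar>)" by (intro sum_mono) auto
  also have "\<dots> \<le> (\<Sum>i<n. \<bar>y i\<bar>)" using k by (intro sum_mono2) auto
  finally show ?thesis using k by simp
qed

lemma walk_max_shift:
  "walk_max n y - walk_max n (\<lambda>i. y (Suc i)) \<le> (if 0 < walk_max n y then y 0 else 0)"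
proof (cases "0 < walk_max n y")
  case True
  obtain k where k: "k \<le> n" "walk_max n y = (\<Sum>i<k. y i)"
    using walk_max_attained by blast
  with True obtain j where j: "k = Suc j" by (cases k) auto
  have "(\<Sum>i<k. y i) = y 0 + (\<Sum>i<j. y (Suc i))"
    unfolding j by (rule sum.lessThan_Suc_shift)
  also have "\<dots> \<le> y 0 + walk_max n (\<lambda>i. y (Suc i))"
    using k j by (intro add_left_mono walk_max_ge) auto
  finally show ?thesis using True k by simp
next
  case False
  then show ?thesis using walk_max_nonneg[of n y] walk_max_nonneg[of n "\<lambda>i. y (Suc i)"] by simp
qed

lemma walk_max_measurable [measurable]:
  "walk_max n \<in> borel_measurable (\<Pi>\<^sub>M i\<in>UNIV. borel)"
  unfolding walk_max_def by measurable

lemma (in prob_space) maximal_inequality: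
  fixes Y :: "nat \<Rightarrow> 'a \<Rightarrow> real"
  assumes ind: "indep_vars (\<lambda>_. borel) Y UNIV"
    and id: "\<And>n. distr M borel (Y n) = distr M borel (Y 0)"
    and int: "integrable M (Y 0)"
  shows "0 \<le> (\<integral>\<omega>. (if 0 < walk_max n (\<lambda>i. Y i \<omega>) then Y 0 \<omega> else 0) \<partial>M)"
proof -
  have rv [measurable]: "\<And>n. random_variable borel (Y n)"
    using ind by (auto simp: indep_vars_def2)
  have int': "integrable M (Y i)" for i
  proof -
    have "integrable (distr M borel (Y i)) (\<lambda>x. x)"
      unfolding id[of i] using int by (subst integrable_distr_eq) auto
    then show ?thesis by (subst (asm) integrable_distr_eq) auto
  qed
  have int_max: "integrable M (\<lambda>\<omega>. walk_max n (\<lambda>i. Y (g i) \<omega>))" for g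
  proof (rule Bochner_Integration.integrable_bound)
    show "integrable M (\<lambda>\<omega>. \<Sum>i<n. \<bar>Y (g i) \<omega>\<bar>)" using int' by auto
    show "AE \<omega> in M. norm (walk_max n (\<lambda>i. Y (g i) \<omega>)) \<le> norm (\<Sum>i<n. \<bar>Y (g i) \<omega>\<bar>)"
      using walk_max_nonneg walk_max_le_sum_abs by (auto intro!: AE_I2 simp: sum_nonneg)
    show "(\<lambda>\<omega>. walk_max n (\<lambda>i. Y (g i) \<omega>)) \<in> borel_measurable M"
      by (rule measurable_compose[OF _ walk_max_measurable])
         (auto intro!: measurable_PiM_single' simp: space_PiM)
  qed
  have seq [measurable]: "(\<lambda>\<omega> i. Y (g i) \<omega>) \<in> measurable M (\<Pi>\<^sub>M i\<in>UNIV. borel)" for g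
    by (auto intro!: measurable_PiM_single' simp: space_PiM)
  have "(\<integral>\<omega>. walk_max n (\<lambda>i. Y (Suc i) \<omega>) \<partial>M)
      = (\<integral>y. walk_max n y \<partial>distr M (\<Pi>\<^sub>M i\<in>UNIV. borel) (\<lambda>\<omega> i. Y (Suc i) \<omega>))"
    using seq[of Suc] by (subst integral_distr) auto
  also have "\<dots> = (\<integral>y. walk_max n y \<partial>distr M (\<Pi>\<^sub>M i\<in>UNIV. borel) (\<lambda>\<omega> i. Y i \<omega>))"
    using iid_shift_distr[OF ind id] by simp
  also have "\<dots> = (\<integral>\<omega>. walk_max n (\<lambda>i. Y i \<omega>) \<partial>M)"
    using seq[of "\<lambda>i. i"] by (subst integral_distr) auto
  finally have "0 = (\<integral>\<omega>. walk_max n (\<lambda>i. Y i \<omega>) - walk_max n (\<lambda>i. Y (Suc i) \<omega>) \<partial>M)"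
    using int_max[of "\<lambda>i. i"] int_max[of Suc] by simp
  also have "\<dots> \<le> (\<integral>\<omega>. (if 0 < walk_max n (\<lambda>i. Y i \<omega>) then Y 0 \<omega> else 0) \<partial>M)"
  proof (rule integral_mono)
    show "integrable M (\<lambda>\<omega>. if 0 < walk_max n (\<lambda>i. Y i \<omega>) then Y 0 \<omega> else 0)"
      by (rule Bochner_Integration.integrable_bound[OF int])
         (use borel_measurable_integrable[OF int_max[of "\<lambda>i. i"]] in \<open>auto intro: AE_I2\<close>)
    show "walk_max n (\<lambda>i. Y i \<omega>) - walk_max n (\<lambda>i. Y (Suc i) \<omega>)
        \<le> (if 0 < walk_max n (\<lambda>i. Y i \<omega>) then Y 0 \<omega> else 0)" for \<omega>
      by (rule walk_max_shift)
  qed (use int_max[of "\<lambda>i. i"] int_max[of Suc] in auto)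
  finally show ?thesis .
qed

lemma unbounded_sums_tail:
  fixes y :: "nat \<Rightarrow> real"
  shows "(\<forall>K::nat. \<exists>n. real K < (\<Sum>i<n. y i)) \<longleftrightarrow> (\<forall>K::nat. \<exists>n\<ge>m. real K < (\<Sum>i=m..<n. y i))"
proof
  assume L: "\<forall>K::nat. \<exists>n. real K < (\<Sum>i<n. y i)"
  show "\<forall>K::nat. \<exists>n\<ge>m. real K < (\<Sum>i=m..<n. y i)"
  proof
    fix K :: nat
    obtain K' :: nat where K': "real K + (\<Sum>i<m. \<bar>y i\<bar>) < real K'" using reals_Archimedean2 by blast
    obtain n where n: "real K' < (\<Sum>i<n. y i)" using L by blast
    have "m \<le> n"
    proof (rule ccontr)
      assume "\<not> m \<le> n"
      then have "(\<Sum>i<n. \<bar>y i\<bar>) \<le> (\<Sum>i<m. \<bar>y i\<bar>)" by (intro sum_mono2) auto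
      moreover have "(\<Sum>i<n. y i) \<le> (\<Sum>i<n. \<bar>y i\<bar>)" by (intro sum_mono) auto
      ultimately show False using K' n by linarith
    qed
    moreover have "(\<Sum>i<n. y i) = (\<Sum>i<m. y i) + (\<Sum>i=m..<n. y i)"
      using sum.atLeastLessThan_concat[of 0 m n y] \<open>m \<le> n\<close> by (simp add: lessThan_atLeast0)
    moreover have "(\<Sum>i<m. y i) \<le> (\<Sum>i<m. \<bar>y i\<bar>)" by (intro sum_mono) auto
    ultimately show "\<exists>n\<ge>m. real K < (\<Sum>i=m..<n. y i)" using K' n by (intro exI[of _ n]) linarith
  qed
next
  assume R: "\<forall>K::nat. \<exists>n\<ge>m. real K < (\<Sum>i=m..<n. y i)"
  show "\<forall>K::nat. \<exists>n. real K < (\<Sum>i<n. y i)"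
  proof
    fix K :: nat
    obtain K' :: nat where K': "real K + \<bar>\<Sum>i<m. y i\<bar> < real K'" using reals_Archimedean2 by blast
    obtain n where n: "n \<ge> m" "real K' < (\<Sum>i=m..<n. y i)" using R by blast
    have "(\<Sum>i<n. y i) = (\<Sum>i<m. y i) + (\<Sum>i=m..<n. y i)"
      using sum.atLeastLessThan_concat[of 0 m n y] \<open>m \<le> n\<close> by (simp add: lessThan_atLeast0)
    then show "\<exists>n. real K < (\<Sum>i<n. y i)" using K' n by (intro exI[of _ n]) linarith
  qed
qed

lemma (in prob_space) unbounded_sums_0_1:
  fixes Y :: "nat \<Rightarrow> 'a \<Rightarrow> real"
  assumes ind: "indep_vars (\<lambda>_. borel) Y UNIV"
  defines "E \<equiv> {\<omega>\<in>space M. \<forall>K::nat. \<exists>n. real K < (\<Sum>i<n. Y i \<omega>)}"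
  shows "prob E = 0 \<or> prob E = 1"
proof (rule kolmogorov_0_1_law)
  let ?A = "\<lambda>i. sigma_sets (space M) {Y i -` B \<inter> space M | B. B \<in> sets borel}"
  show "sigma_algebra (space M) (?A i)" for i
    by (rule sigma_algebra_sigma_sets) auto
  show "indep_sets ?A UNIV"
    using ind by (simp add: indep_vars_def)
  show "E \<in> tail_events ?A"
    unfolding tail_events_def
  proof
    fix m :: nat
    let ?G = "\<Union>(?A ` {m..})"
    let ?N = "sigma (space M) ?G"
    have G: "?G \<subseteq> Pow (space M)"
      using sigma_sets_into_sp[of "{Y i -` B \<inter> space M | B. B \<in> sets borel}" "space M" for i] by blast
    have [simp]: "space ?N = space M" using G by (rule space_measure_of)
    have sets: "sets ?N = sigma_sets (space M) ?G" using G by (rule sets_measure_of)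
    have meas: "Y i \<in> borel_measurable ?N" if "m \<le> i" for i
    proof (rule measurableI)
      fix B :: "real set" assume "B \<in> sets borel"
      then have "Y i -` B \<inter> space M \<in> ?A i" by blast
      then show "Y i -` B \<inter> space ?N \<in> sets ?N"
        unfolding sets using that by auto
    qed simp
    have sums [measurable]: "(\<lambda>\<omega>. \<Sum>i=m..<n. Y i \<omega>) \<in> borel_measurable ?N" for n
      by (intro borel_measurable_sum meas) auto
    have "E = {\<omega>\<in>space ?N. \<forall>K::nat. \<exists>n. n \<ge> m \<and> real K < (\<Sum>i=m..<n. Y i \<omega>)}"
      unfolding E_def by (subst unbounded_sums_tail[of _ m]) simp
    also have "\<dots> \<in> sets ?N" by measurable
    finally show "E \<in> sigma_sets (space M) ?G" unfolding sets .
  qed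
qed

lemma (in prob_space) negative_drift_bounded_above:
  fixes Y :: "nat \<Rightarrow> 'a \<Rightarrow> real"
  assumes ind: "indep_vars (\<lambda>_. borel) Y UNIV"
    and id: "\<And>n. distr M borel (Y n) = distr M borel (Y 0)"
    and int: "integrable M (Y 0)" and neg: "expectation (Y 0) < 0"
  shows "AE \<omega> in M. \<exists>K::nat. \<forall>n. (\<Sum>i<n. Y i \<omega>) \<le> real K"
proof -
  have rv [measurable]: "\<And>n. random_variable borel (Y n)"
    using ind by (auto simp: indep_vars_def2)
  define E where "E = {\<omega>\<in>space M. \<forall>K::nat. \<exists>n. real K < (\<Sum>i<n. Y i \<omega>)}"
  have E [measurable]: "E \<in> events" unfolding E_def by measurable
  have "prob E \<noteq> 1"
  proof
    assume "prob E = 1"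
    then have ae: "AE \<omega> in M. \<omega> \<in> E" by (simp add: prob_eq_1 E)
    have "(\<lambda>n. \<integral>\<omega>. (if 0 < walk_max n (\<lambda>i. Y i \<omega>) then Y 0 \<omega> else 0) \<partial>M) \<longlonglongrightarrow> (\<integral>\<omega>. Y 0 \<omega> \<partial>M)"
    proof (rule integral_dominated_convergence)
      show "integrable M (\<lambda>\<omega>. norm (Y 0 \<omega>))" using int by simp
      show "AE \<omega> in M. (\<lambda>n. if 0 < walk_max n (\<lambda>i. Y i \<omega>) then Y 0 \<omega> else 0) \<longlonglongrightarrow> Y 0 \<omega>"
        using ae
      proof eventually_elim
        case (elim \<omega>)
        then have "\<exists>k. real 0 < (\<Sum>i<k. Y i \<omega>)" unfolding E_def by blast
        then obtain k where k: "0 < (\<Sum>i<k. Y i \<omega>)" by auto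
        have "eventually (\<lambda>n. (if 0 < walk_max n (\<lambda>i. Y i \<omega>) then Y 0 \<omega> else 0) = Y 0 \<omega>) sequentially"
          using eventually_ge_at_top[of k]
          by eventually_elim (use k walk_max_pos_iff in auto)
        then show ?case by (rule tendsto_eventually)
      qed
      show "(\<lambda>\<omega>. if 0 < walk_max n (\<lambda>i. Y i \<omega>) then Y 0 \<omega> else 0) \<in> borel_measurable M" for n
        unfolding walk_max_pos_iff by measurable
    qed (auto intro: AE_I2)
    then have "0 \<le> (\<integral>\<omega>. Y 0 \<omega> \<partial>M)"
      by (rule LIMSEQ_le_const) (use maximal_inequality[OF ind id int] in auto)
    with neg show False by simp
  qed
  with unbounded_sums_0_1[OF ind] have "prob E = 0" unfolding E_def by blast
  then have "AE \<omega> in M. \<omega> \<notin> E" by (simp add: prob_eq_0 E)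
  then show ?thesis
    by (rule AE_mp) (auto intro!: AE_I2 simp: E_def not_less)
qed

theorem (in prob_space) strong_law_of_large_numbers:
  fixes Y :: "nat \<Rightarrow> 'a \<Rightarrow> real"
  assumes ind: "indep_vars (\<lambda>_. borel) Y UNIV"
    and id: "\<And>n. distr M borel (Y n) = distr M borel (Y 0)"
    and int: "integrable M (Y 0)"
  shows "AE \<omega> in M. (\<lambda>n. (\<Sum>i<n. Y i \<omega>) / real n) \<longlonglongrightarrow> expectation (Y 0)"
proof -
  have rv [measurable]: "\<And>n. random_variable borel (Y n)"
    using ind by (auto simp: indep_vars_def2)
  have bd: "AE \<omega> in M. \<exists>K::nat. \<forall>n. (\<Sum>i<n. s * (Y i \<omega> - expectation (Y 0)) - e) \<le> real K"
    if "e > 0" for s e :: real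
  proof -
    have 1: "indep_vars (\<lambda>_. borel) (\<lambda>i \<omega>. s * (Y i \<omega> - expectation (Y 0)) - e) UNIV"
      by (rule indep_vars_compose2[OF ind]) simp
    have 2: "distr M borel (\<lambda>\<omega>. s * (Y n \<omega> - expectation (Y 0)) - e)
        = distr M borel (\<lambda>\<omega>. s * (Y 0 \<omega> - expectation (Y 0)) - e)" for n
      using distr_distr[of "\<lambda>y. s * (y - expectation (Y 0)) - e" borel borel "Y n" M]
        distr_distr[of "\<lambda>y. s * (y - expectation (Y 0)) - e" borel borel "Y 0" M] id[of n]
      by (simp add: comp_def)
    show ?thesis
      by (rule negative_drift_bounded_above[OF 1 2]) (use int that in \<open>auto simp: prob_space\<close>)
  qed
  have "AE \<omega> in M. \<forall>j::nat. (\<exists>K::nat. \<forall>n. (\<Sum>i<n. 1 * (Y i \<omega> - expectation (Y 0)) - 1 / real (Suc j)) \<le> real K)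
      \<and> (\<exists>K::nat. \<forall>n. (\<Sum>i<n. (-1) * (Y i \<omega> - expectation (Y 0)) - 1 / real (Suc j)) \<le> real K)"
    unfolding AE_all_countable by (intro allI AE_conjI bd) auto
  then show ?thesis
  proof eventually_elim
    case (elim \<omega>)
    let ?m = "expectation (Y 0)"
    show ?case
    proof (rule LIMSEQ_I)
      fix r :: real assume "0 < r"
      then obtain j :: nat where j: "1 / real (Suc j) < r / 2"
        using nat_approx_posE[of "r/2"] by auto
      obtain K1 K2 :: nat where
        K1: "\<And>n. (\<Sum>i<n. 1 * (Y i \<omega> - ?m) - 1 / real (Suc j)) \<le> real K1" and
        K2: "\<And>n. (\<Sum>i<n. (-1) * (Y i \<omega> - ?m) - 1 / real (Suc j)) \<le> real K2"
        using elim by meson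
      obtain n0 :: nat where n0: "2 * (real K1 + real K2) / r < real n0"
        using reals_Archimedean2 by blast
      have "norm ((\<Sum>i<n. Y i \<omega>) / real n - ?m) < r" if "n \<ge> Suc n0" for n
      proof -
        have n: "real n > 0" "real n > real n0" using that by auto
        have "2 * (real K1 + real K2) < r * real n0"
          using n0 \<open>0 < r\<close> by (simp add: field_simps)
        also have "\<dots> \<le> r * real n" using n \<open>0 < r\<close> by simp
        finally have a: "real K1 + real K2 < (r * real n) / 2" by simp
        have "real n * (1 / real (Suc j)) \<le> real n * (r / 2)"
          using n j by (intro mult_left_mono) auto
        then have b: "real n * (1 / real (Suc j)) \<le> (r * real n) / 2" by (simp add: mult.commute)
        have "(\<Sum>i<n. Y i \<omega>) - real n * ?m - real n * (1 / real (Suc j)) \<le> real K1"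
          using K1[of n] by (simp add: sum_subtractf)
        moreover have "- ((\<Sum>i<n. Y i \<omega>) - real n * ?m) - real n * (1 / real (Suc j)) \<le> real K2"
          using K2[of n] by (simp add: sum_subtractf)
        ultimately have "\<bar>(\<Sum>i<n. Y i \<omega>) - real n * ?m\<bar> < r * real n"
          using a b of_nat_0_le_iff[of K1] of_nat_0_le_iff[of K2] unfolding abs_less_iff by linarith
        moreover have "(\<Sum>i<n. Y i \<omega>) / real n - ?m = ((\<Sum>i<n. Y i \<omega>) - real n * ?m) / real n"
          using n by (simp add: field_simps)
        ultimately show ?thesis using n by (simp add: abs_divide field_simps)
      qed
      then show "\<exists>no. \<forall>n\<ge>no. norm ((\<Sum>i<n. Y i \<omega>) / real n - ?m) < r" by blast
    qed
  qed
qed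

section \<open>Pathwise analysis of the evolution\<close>

lemma rank_bij_betw:
  assumes fin: "finite S"
    and irr: "\<And>v. v \<in> S \<Longrightarrow> \<not> R v v"
    and tr: "\<And>u v w. u \<in> S \<Longrightarrow> v \<in> S \<Longrightarrow> w \<in> S \<Longrightarrow> R u v \<Longrightarrow> R v w \<Longrightarrow> R u w"
    and tot: "\<And>v w. v \<in> S \<Longrightarrow> w \<in> S \<Longrightarrow> v \<noteq> w \<Longrightarrow> R v w \<or> R w v"
  shows "bij_betw (\<lambda>v. card {w \<in> S. R w v}) S {..<card S}"
proof -
  let ?r = "\<lambda>v. card {w \<in> S. R w v}"
  have less: "?r v < ?r w" if "v \<in> S" "w \<in> S" "R v w" for v w
  proof (rule psubset_card_mono)
    show "{u \<in> S. R u v} \<subset> {u \<in> S. R u w}"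
      using that irr tr by blast
  qed (use fin in simp)
  have inj: "inj_on ?r S"
  proof (rule inj_onI)
    fix v w assume "v \<in> S" "w \<in> S" "?r v = ?r w"
    then show "v = w" using less[of v w] less[of w v] tot[of v w] by force
  qed
  have sub: "?r ` S \<subseteq> {..<card S}"
  proof clarify
    fix v assume "v \<in> S"
    then have "{w \<in> S. R w v} \<subset> S" using irr by blast
    then show "?r v < card S" by (rule psubset_card_mono[OF fin])
  qed
  have "?r ` S = {..<card S}"
    by (rule card_subset_eq[OF _ sub]) (use card_image[OF inj] in auto)
  with inj show ?thesis by (simp add: bij_betw_def)
qed

definition lex_before :: "nat \<times> nat \<Rightarrow> nat \<times> nat \<Rightarrow> bool" where
  "lex_before w v \<longleftrightarrow> fst w < fst v \<or> (fst w = fst v \<and> snd w < snd v)"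

definition lex_rank :: "(nat \<times> nat) set \<Rightarrow> nat \<times> nat \<Rightarrow> nat" where
  "lex_rank S v = card {w \<in> S. lex_before w v}"

lemma lex_rank_segment_bij:
  assumes "finite {v \<in> S. fst v < n}"
  shows "bij_betw (lex_rank S) {v \<in> S. fst v < n} {..<card {v \<in> S. fst v < n}}"
proof -
  let ?T = "{v \<in> S. fst v < n}"
  have "bij_betw (\<lambda>v. card {w \<in> ?T. lex_before w v}) ?T {..<card ?T}"
    by (rule rank_bij_betw) (use assms in \<open>auto simp: lex_before_def prod_eq_iff\<close>)
  moreover have "card {w \<in> ?T. lex_before w v} = lex_rank S v" if "v \<in> ?T" for v
    unfolding lex_rank_def by (rule arg_cong[where f = card]) (use that in \<open>auto simp: lex_before_def\<close>)
  ultimately show ?thesis by (subst bij_betw_cong) auto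
qed

lemma lex_rank_inj:
  assumes fin: "\<And>n. finite {v \<in> S. fst v < n}"
    and "v \<in> S" "w \<in> S" "lex_rank S v = lex_rank S w"
  shows "v = w"
proof -
  let ?n = "Suc (max (fst v) (fst w))"
  have "inj_on (lex_rank S) {v \<in> S. fst v < ?n}"
    using lex_rank_segment_bij[OF fin[of ?n]] by (rule bij_betw_imp_inj_on)
  then show ?thesis by (rule inj_onD) (use assms in auto)
qed

lemma card_lowest:
  assumes "finite S"
  shows "card (lowest m g S) = min m (card S)"
proof -
  let ?R = "\<lambda>w v. g w < g v \<or> (g w = g v \<and> (fst w < fst v \<or> (fst w = fst v \<and> snd w < snd v)))"
  let ?r = "\<lambda>v. card {w \<in> S. ?R w v}"
  have bij: "bij_betw ?r S {..<card S}"
    by (rule rank_bij_betw) (use assms in \<open>auto simp: prod_eq_iff\<close>)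
  have low: "lowest m g S = {v \<in> S. ?r v < m}" by (simp add: lowest_def)
  have "?r ` lowest m g S = {..<m} \<inter> ?r ` S" unfolding low by auto
  also have "\<dots> = {..<min m (card S)}" using bij by (auto simp: bij_betw_def)
  finally have "card (?r ` lowest m g S) = min m (card S)" by simp
  moreover have "inj_on ?r (lowest m g S)"
    using bij by (auto simp: bij_betw_def low intro: inj_on_subset)
  ultimately show ?thesis by (simp add: card_image)
qed

lemma lowest_lower_part:
  assumes "\<And>a b. a \<le> b \<Longrightarrow> Q b \<Longrightarrow> Q a"
  shows "{v \<in> lowest m g S. Q (g v)} = lowest m g {v \<in> S. Q (g v)}"
proof -
  have "{w \<in> S. Q (g w) \<and> (g w < g v \<or> (g w = g v \<and> (fst w < fst v \<or> (fst w = fst v \<and> snd w < snd v))))}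
      = {w \<in> S. g w < g v \<or> (g w = g v \<and> (fst w < fst v \<or> (fst w = fst v \<and> snd w < snd v)))}"
    if "Q (g v)" for v
    using assms that by (auto dest: less_imp_le)
  then show ?thesis unfolding lowest_def by (auto simp: conj_assoc)
qed

definition added :: "(nat \<Rightarrow> bool) \<Rightarrow> (nat \<Rightarrow> nat) \<Rightarrow> (nat \<times> nat) set" where
  "added c z = {v. c (fst v) \<and> snd v < z (fst v)}"

lemma finite_added: "finite {v \<in> added c z. fst v < n}"
proof (rule finite_subset)
  show "{v \<in> added c z. fst v < n} \<subseteq> (SIGMA m:{..<n}. {..<z m})" by (auto simp: added_def)
qed auto

lemma card_added:
  "card {v \<in> added c z. fst v < n \<and> Q (u (fst v) (snd v))}
    = (\<Sum>m<n. if c m then card {k. k < z m \<and> Q (u m k)} else 0)"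
proof (induction n)
  case (Suc n)
  let ?A = "\<lambda>n. {v \<in> added c z. fst v < n \<and> Q (u (fst v) (snd v))}"
  let ?N = "if c n then Pair n ` {k. k < z n \<and> Q (u n k)} else {}"
  have "?A (Suc n) = ?A n \<union> ?N" by (auto simp: added_def less_Suc_eq)
  moreover have "finite (?A n)" by (rule finite_subset[OF _ finite_added[of c z n]]) auto
  moreover have "finite ?N" by auto
  moreover have "?A n \<inter> ?N = {}" by auto
  moreover have "card ?N = (if c n then card {k. k < z n \<and> Q (u n k)} else 0)"
    by (auto intro!: card_image inj_onI)
  ultimately show ?case using Suc by (simp add: card_Un_disjoint del: if_split)
qed simp

lemma evol_subset_added: "evol c z x u n \<subseteq> {v \<in> added c z. fst v < n}"
  by (induction n) (auto simp: added_def)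

lemma finite_evol: "finite (evol c z x u n)"
  using finite_subset[OF evol_subset_added finite_added] .

lemma card_evol_lower_Suc:
  fixes c z x u and Q :: "real \<Rightarrow> bool"
  defines "a \<equiv> \<lambda>n. card {v \<in> evol c z x u n. Q (u (fst v) (snd v))}"
  assumes Q: "\<And>a b. a \<le> b \<Longrightarrow> Q b \<Longrightarrow> Q a"
  shows "a (Suc n) = (if c n then a n + card {k. k < z n \<and> Q (u n k)} else a n - x n)"
proof -
  let ?V = "evol c z x u n" and ?g = "\<lambda>v. u (fst v) (snd v)"
  let ?L = "{v \<in> ?V. Q (?g v)}"
  have fin: "finite ?L" using finite_evol by simp
  show ?thesis
  proof (cases "c n")
    case True
    then have "{v \<in> evol c z x u (Suc n). Q (?g v)} = ?L \<union> Pair n ` {k. k < z n \<and> Q (u n k)}"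
      by auto
    moreover have "?L \<inter> Pair n ` {k. k < z n \<and> Q (u n k)} = {}"
      using evol_subset_added[of c z x u n] by auto
    moreover have "card (Pair n ` {k. k < z n \<and> Q (u n k)}) = card {k. k < z n \<and> Q (u n k)}"
      by (auto intro!: card_image inj_onI)
    ultimately show ?thesis using True fin by (simp add: a_def card_Un_disjoint)
  next
    case False
    then have "{v \<in> evol c z x u (Suc n). Q (?g v)} = ?L - {v \<in> lowest (x n) ?g ?V. Q (?g v)}"
      by auto
    also have "\<dots> = ?L - lowest (x n) ?g ?L"
      using lowest_lower_part[of Q, OF Q] by simp
    finally have diff: "{v \<in> evol c z x u (Suc n). Q (?g v)} = ?L - lowest (x n) ?g ?L" .
    have sub: "lowest (x n) ?g ?L \<subseteq> ?L" unfolding lowest_def by blast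
    have "card {v \<in> evol c z x u (Suc n). Q (?g v)} = card ?L - card (lowest (x n) ?g ?L)"
      unfolding diff by (rule card_Diff_subset[OF finite_subset[OF sub fin] sub])
    also have "\<dots> = card ?L - x n" using card_lowest[OF fin] by simp
    finally show ?thesis using False by (simp add: a_def)
  qed
qed

context
  fixes c :: "nat \<Rightarrow> bool" and a b x :: "nat \<Rightarrow> nat"
  assumes a0: "a 0 = 0" and aSuc: "\<And>n. a (Suc n) = (if c n then a n + b n else a n - x n)"
begin

lemma reflected_walk_eq_increment:
  "\<exists>m\<le>n. real (a n) = (\<Sum>i<n. if c i then real (b i) else - real (x i))
                     - (\<Sum>i<m. if c i then real (b i) else - real (x i))"
proof (induction n)
  case (Suc n)
  then obtain m where m: "m \<le> n" "real (a n) = (\<Sum>i<n. if c i then real (b i) else - real (x i))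
                     - (\<Sum>i<m. if c i then real (b i) else - real (x i))" by blast
  show ?case
  proof (cases "c n \<or> x n \<le> a n")
    case True
    then show ?thesis using m by (intro exI[of _ m]) (auto simp: aSuc of_nat_diff)
  next
    case False
    then show ?thesis by (intro exI[of _ "Suc n"]) (auto simp: aSuc)
  qed
qed (simp add: a0)

lemma reflected_walk_ge:
  "(\<Sum>i<n. if c i then real (b i) else - real (x i)) \<le> real (a n)"
  by (induction n) (auto simp: a0 aSuc)

lemma reflected_walk_hits_zero:
  assumes lim: "filterlim (\<lambda>n. \<Sum>i<n. if c i then real (b i) else - real (x i)) at_bot sequentially"
  shows "\<exists>\<^sub>\<infinity>n. a n = 0"
proof (rule ccontr)
  let ?S = "\<lambda>n. \<Sum>i<n. if c i then real (b i) else - real (x i)"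
  assume "\<not> ?thesis"
  then obtain n0 where n0: "\<And>n. n \<ge> n0 \<Longrightarrow> a n \<noteq> 0"
    by (auto simp: INFM_nat_le)
  have le: "real (a (n0 + n)) \<le> real (a n0) + ?S (n0 + n) - ?S n0" for n
  proof (induction n)
    case (Suc n)
    have "a (Suc (n0 + n)) \<noteq> 0" by (rule n0) simp
    with Suc show ?case using aSuc[of "n0 + n"] by (auto simp: of_nat_diff split: if_splits)
  qed simp
  have "eventually (\<lambda>n. ?S n \<le> ?S n0 - real (a n0) - 1) sequentially"
    using lim by (simp add: filterlim_at_bot)
  then obtain n where "n \<ge> n0" "?S n \<le> ?S n0 - real (a n0) - 1"
    using eventually_happens[OF eventually_conj[OF _ eventually_ge_at_top[of n0]]] by force
  then show False using le[of "n - n0"] by simp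
qed

end

lemma card_sym_diff_evol:
  fixes c z x u f n
  defines "g \<equiv> \<lambda>v. u (fst v) (snd v)"
  defines "V \<equiv> evol c z x u n"
  defines "B \<equiv> {v \<in> added c z. fst v < n \<and> f < g v}"
  shows "real (card ((g ` V - g ` B) \<union> (g ` B - g ` V)))
    \<le> 2 * real (card {v \<in> V. g v \<le> f})
      - (\<Sum>m<n. if c m then real (card {k. k < z m \<and> u m k \<le> f}) else - real (x m))"
proof -
  let ?A = "{v \<in> added c z. fst v < n}"
  let ?R = "\<Sum>m<n. if c m then 0 else real (x m)"
  have finA: "finite ?A" by (rule finite_added)
  have finV: "finite V" unfolding V_def by (rule finite_evol)
  have VA: "V \<subseteq> ?A" unfolding V_def by (rule evol_subset_added)
  have finB: "finite B" by (rule finite_subset[OF _ finA]) (auto simp: B_def)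
  have "(\<Sum>m<n. if c m then real (z m) else - real (x m)) \<le> real (card V)"
    using reflected_walk_ge[of "\<lambda>n. card {v \<in> evol c z x u n. True}" c z x n]
      card_evol_lower_Suc[of "\<lambda>_. True" c z x u] by (simp add: V_def)
  moreover have "card ?A = (\<Sum>m<n. if c m then z m else 0)"
    using card_added[of c z n "\<lambda>_. True" u] by (simp cong: if_cong)
  then have "real (card ?A) = (\<Sum>m<n. if c m then real (z m) else 0)"
    by (simp add: of_nat_sum if_distrib cong: if_cong)
  moreover have "(\<Sum>m<n. if c m then real (z m) else - real (x m))
      = (\<Sum>m<n. if c m then real (z m) else 0) - ?R"
    unfolding sum_subtractf[symmetric] by (intro sum.cong) auto
  ultimately have total: "real (card ?A) - ?R \<le> real (card V)" by simp
  have "card {v \<in> ?A. g v \<le> f} = (\<Sum>m<n. if c m then card {k. k < z m \<and> u m k \<le> f} else 0)"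
    using card_added[of c z n "\<lambda>a. a \<le> f" u] by (simp add: g_def conj_assoc)
  then have "real (card {v \<in> ?A. g v \<le> f}) = (\<Sum>m<n. if c m then real (card {k. k < z m \<and> u m k \<le> f}) else 0)"
    by (simp add: of_nat_sum if_distrib cong: if_cong)
  moreover have "(\<Sum>m<n. if c m then real (card {k. k < z m \<and> u m k \<le> f}) else - real (x m))
      = (\<Sum>m<n. if c m then real (card {k. k < z m \<and> u m k \<le> f}) else 0) - ?R"
    unfolding sum_subtractf[symmetric] by (intro sum.cong) auto
  ultimately have low: "(\<Sum>m<n. if c m then real (card {k. k < z m \<and> u m k \<le> f}) else - real (x m))
      = real (card {v \<in> ?A. g v \<le> f}) - ?R" by simp
  have "card ({v \<in> ?A. g v \<le> f} \<union> B) = card {v \<in> ?A. g v \<le> f} + card B"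
    using finB finite_subset[OF _ finA, of "{v \<in> ?A. g v \<le> f}"]
    by (intro card_Un_disjoint) (auto simp: B_def)
  moreover have "{v \<in> ?A. g v \<le> f} \<union> B = ?A" by (auto simp: B_def)
  ultimately have A: "card ?A = card {v \<in> ?A. g v \<le> f} + card B" by simp
  have "V = {v \<in> V. g v \<le> f} \<union> (V \<inter> B)" using VA by (auto simp: B_def)
  moreover have "{v \<in> V. g v \<le> f} \<inter> (V \<inter> B) = {}" by (auto simp: B_def)
  ultimately have "card V = card {v \<in> V. g v \<le> f} + card (V \<inter> B)"
    using card_Un_disjoint[of "{v \<in> V. g v \<le> f}" "V \<inter> B"] finV by simp
  moreover have "card B = card (V \<inter> B) + card (B - V)"
    using card_Int_Diff[OF finB, of V] by (simp add: Int_commute)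
  moreover have "card ((V - B) \<union> (B - V)) = card {v \<in> V. g v \<le> f} + card (B - V)"
  proof -
    have "V - B = {v \<in> V. g v \<le> f}" using VA by (auto simp: B_def)
    then show ?thesis using finV finB by (subst card_Un_disjoint) auto
  qed
  moreover have "card ((g ` V - g ` B) \<union> (g ` B - g ` V)) \<le> card (g ` ((V - B) \<union> (B - V)))"
    using finV finB by (intro card_mono) auto
  moreover have "card (g ` ((V - B) \<union> (B - V))) \<le> card ((V - B) \<union> (B - V))"
    using finV finB by (intro card_image_le) auto
  ultimately show ?thesis using total A unfolding low by linarith
qed

section \<open>Thinning of the added fitnesses\<close>

lemma (in prob_space) iid_from_rectangles:
  fixes Y :: "nat \<Rightarrow> 'a \<Rightarrow> 'b"
  assumes meas: "\<And>i. Y i \<in> measurable M N"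
    and F: "prob_space F" "sets F = sets N"
    and rect: "\<And>k B. (\<And>i. B i \<in> sets N) \<Longrightarrow>
      prob {\<omega>\<in>space M. \<forall>i<k. Y i \<omega> \<in> B i} = (\<Prod>i<k. measure F (B i))"
  shows "indep_vars (\<lambda>_. N) Y UNIV" and "distr M N (Y i) = F"
proof -
  interpret F: prob_space F by fact
  have spF: "space F = space N" using F(2) by (rule sets_eq_imp_space_eq)
  have rectJ: "prob (\<Inter>j\<in>J. Y j -` B j \<inter> space M) = (\<Prod>j\<in>J. measure F (B j))"
    if J: "finite J" "J \<noteq> {}" and B: "\<And>j. j \<in> J \<Longrightarrow> B j \<in> sets N" for J B
  proof -
    let ?k = "Suc (Max J)" and ?B = "\<lambda>j. if j \<in> J then B j else space N"
    have sub: "J \<subseteq> {..<?k}" using J Max_ge[OF J(1)] by (auto simp: less_Suc_eq_le)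
    have "(\<Inter>j\<in>J. Y j -` B j \<inter> space M) = {\<omega>\<in>space M. \<forall>i<?k. Y i \<omega> \<in> ?B i}"
    proof (intro set_eqI iffI)
      fix \<omega> assume "\<omega> \<in> (\<Inter>j\<in>J. Y j -` B j \<inter> space M)"
      then show "\<omega> \<in> {\<omega>\<in>space M. \<forall>i<?k. Y i \<omega> \<in> ?B i}"
        using J measurable_space[OF meas] by auto
    next
      fix \<omega> assume "\<omega> \<in> {\<omega>\<in>space M. \<forall>i<?k. Y i \<omega> \<in> ?B i}"
      then have "\<omega> \<in> space M" "\<And>i. i < ?k \<Longrightarrow> Y i \<omega> \<in> ?B i" by blast+
      moreover have "j \<in> J \<Longrightarrow> j < ?k" for j using sub by blast
      ultimately show "\<omega> \<in> (\<Inter>j\<in>J. Y j -` B j \<inter> space M)" by fastforce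
    qed
    then have "prob (\<Inter>j\<in>J. Y j -` B j \<inter> space M) = (\<Prod>i<?k. measure F (?B i))"
      using rect[of ?B ?k] B by simp
    also have "\<dots> = (\<Prod>j\<in>J. measure F (?B j))"
      by (rule prod.mono_neutral_right) (use sub F.prob_space spF in auto)
    finally show ?thesis by simp
  qed
  have one: "prob (Y j -` B \<inter> space M) = measure F B" if "B \<in> sets N" for j B
    using rectJ[of "{j}" "\<lambda>_. B"] that by simp
  show "distr M N (Y i) = F"
  proof (rule measure_eqI)
    fix A assume "A \<in> sets (distr M N (Y i))"
    then show "emeasure (distr M N (Y i)) A = emeasure F A"
      using meas one by (simp add: emeasure_distr emeasure_eq_measure F.emeasure_eq_measure)
  qed (simp add: F)
  show "indep_vars (\<lambda>_. N) Y UNIV"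
    unfolding indep_vars_def2
  proof (intro conjI ballI meas indep_setsI)
    fix A and J :: "nat set"
    assume J: "J \<noteq> {}" "finite J" and A: "\<forall>j\<in>J. A j \<in> {Y j -` B \<inter> space M |B. B \<in> sets N}"
    then obtain B where B: "\<And>j. j \<in> J \<Longrightarrow> B j \<in> sets N" "\<And>j. j \<in> J \<Longrightarrow> A j = Y j -` B j \<inter> space M"
      by (simp, metis)
    have "prob (\<Inter>j\<in>J. A j) = (\<Prod>j\<in>J. measure F (B j))"
      using rectJ[of J B] J B by simp
    also have "\<dots> = (\<Prod>j\<in>J. prob (A j))" using B one by simp
    finally show "prob (\<Inter>j\<in>J. A j) = (\<Prod>j\<in>J. prob (A j))" .
  qed (use meas in \<open>auto intro: measurable_sets\<close>)
qed

text \<open>The added labels of fitness above f, where the labels in D are exempt from the fitness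
  condition; the exemption makes membership independent of the fitnesses of D.\<close>

definition sel :: "(nat \<times> nat) set \<Rightarrow> real \<Rightarrow> (idx \<Rightarrow> real) \<Rightarrow> (nat \<times> nat) set" where
  "sel D f w = {v. w (IC (fst v)) = 1 \<and> real (snd v) < w (IZ (fst v)) \<and>
                  (v \<in> D \<or> f < w (IU (fst v) (snd v)))}"

lemma finite_sel_segment: "finite {v \<in> sel D f w. fst v < n}"
proof (rule finite_subset)
  show "{v \<in> sel D f w. fst v < n} \<subseteq> (SIGMA m:{..<n}. {k. real k < w (IZ m)})"
    by (auto simp: sel_def)
  have "finite {k. real k < r}" for r
  proof (rule finite_subset)
    show "{k. real k < r} \<subseteq> {..<nat \<lceil>r\<rceil>}" by (auto simp: zless_nat_eq_int_zless less_ceiling_iff)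
  qed simp
  then show "finite (SIGMA m:{..<n}. {k. real k < w (IZ m)})" by auto
qed

lemma pred_lex_rank_sel:
  assumes w [measurable]: "\<And>j. (\<lambda>x. w x j) \<in> borel_measurable N"
  shows "{x\<in>space N. v \<in> sel D f (w x) \<and> lex_rank (sel D f (w x)) v = i} \<in> sets N"
proof -
  have s [measurable]: "Measurable.pred N (\<lambda>x. v \<in> sel D f (w x))" for v
    unfolding sel_def by simp
  have "lex_rank (sel D f (w x)) v
      = card {m. prod_decode m \<in> sel D f (w x) \<and> lex_before (prod_decode m) v}" for x
    unfolding lex_rank_def
    by (rule bij_betw_same_card[of prod_encode], rule bij_betw_byWitness[where f' = prod_decode]) auto
  moreover have "(\<lambda>x. card {m. prod_decode m \<in> sel D f (w x) \<and> lex_before (prod_decode m) v})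
      \<in> measurable N (count_space UNIV)"
    by (rule measurable_card) simp
  ultimately have [measurable]: "(\<lambda>x. lex_rank (sel D f (w x)) v) \<in> measurable N (count_space UNIV)"
    by simp
  show ?thesis by measurable
qed

definition sel_index :: "real \<Rightarrow> nat \<Rightarrow> (idx \<Rightarrow> real) \<Rightarrow> (nat \<times> nat) option" where
  "sel_index f i w = (if \<exists>v. v \<in> sel {} f w \<and> lex_rank (sel {} f w) v = i
     then Some (THE v. v \<in> sel {} f w \<and> lex_rank (sel {} f w) v = i) else None)"

lemma sel_index_eq_Some_iff:
  "sel_index f i w = Some v \<longleftrightarrow> v \<in> sel {} f w \<and> lex_rank (sel {} f w) v = i"
proof (cases "\<exists>v'. v' \<in> sel {} f w \<and> lex_rank (sel {} f w) v' = i")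
  case True
  then obtain v' where v': "v' \<in> sel {} f w" "lex_rank (sel {} f w) v' = i" by blast
  have uniq: "u = v'" if "u \<in> sel {} f w" "lex_rank (sel {} f w) u = i" for u
    using lex_rank_inj[OF finite_sel_segment, of u "{}" f w v'] that v' by simp
  have "(THE v. v \<in> sel {} f w \<and> lex_rank (sel {} f w) v = i) = v'"
    using v' uniq by (intro the_equality) blast+
  then have "sel_index f i w = Some v'" using True by (simp add: sel_index_def)
  then show ?thesis using uniq v' by (metis option.inject)
next
  case False
  then have "sel_index f i w = None" unfolding sel_index_def by (rule if_not_P)
  with False show ?thesis by (metis option.distinct(1))
qed

definition nth_fitness :: "real \<Rightarrow> nat \<Rightarrow> (idx \<Rightarrow> real) \<Rightarrow> real" where
  "nth_fitness f i w = (case sel_index f i w of None \<Rightarrow> 0 | Some v \<Rightarrow> w (IU (fst v) (snd v)))"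

lemma measurable_nth_fitness:
  assumes w [measurable]: "\<And>j. (\<lambda>x. w x j) \<in> borel_measurable N"
  shows "(\<lambda>x. nth_fitness f i (w x)) \<in> borel_measurable N"
proof -
  have S: "(\<lambda>x. sel_index f i (w x)) -` {Some v} \<inter> space N \<in> sets N" for v
  proof -
    have "(\<lambda>x. sel_index f i (w x)) -` {Some v} \<inter> space N
        = {x\<in>space N. v \<in> sel {} f (w x) \<and> lex_rank (sel {} f (w x)) v = i}"
      by (auto simp: sel_index_eq_Some_iff)
    then show ?thesis using pred_lex_rank_sel[OF w] by simp
  qed
  have "(\<lambda>x. sel_index f i (w x)) -` {None} \<inter> space N
      = space N - (\<Union>v. (\<lambda>x. sel_index f i (w x)) -` {Some v} \<inter> space N)"
    by (auto simp: not_Some_eq[symmetric] simp del: not_Some_eq)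
  also have "\<dots> \<in> sets N" using S by (intro sets.compl_sets sets.countable_UN) auto
  finally have "(\<lambda>x. sel_index f i (w x)) -` {a} \<inter> space N \<in> sets N" for a
    using S by (cases a) auto
  then have idx: "(\<lambda>x. sel_index f i (w x)) \<in> measurable N (count_space UNIV)"
    by (subst measurable_count_space_eq2_countable) auto
  show ?thesis
    unfolding nth_fitness_def
  proof (rule measurable_compose_countable[OF _ idx])
    show "(\<lambda>x. case a of None \<Rightarrow> 0 | Some v \<Rightarrow> w x (IU (fst v) (snd v))) \<in> borel_measurable N" for a
      by (cases a) auto
  qed
qed

lemma measure_uniform_above:
  fixes f :: real
  assumes "0 \<le> f" "f < 1" "B \<in> sets borel"
  shows "measure (uniform_measure lborel {0..1}) (B \<inter> {f<..})
    = (1 - f) * measure (uniform_measure lborel {f..1}) B"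
proof -
  have "measure (uniform_measure lborel {0..1}) (B \<inter> {f<..}) = measure lborel ({0..1} \<inter> (B \<inter> {f<..}))"
    using assms by (subst measure_uniform_measure) auto
  also have "\<dots> = measure lborel ({f..1} \<inter> B)"
  proof (rule measure_eq_AE)
    show "AE x in lborel. x \<in> {0..1} \<inter> (B \<inter> {f<..}) \<longleftrightarrow> x \<in> {f..1} \<inter> B"
      using AE_lborel_singleton[of f] by eventually_elim (use assms in auto)
  qed (use assms in auto)
  also have "\<dots> = (1 - f) * measure (uniform_measure lborel {f..1}) B"
    using assms by (subst measure_uniform_measure) auto
  finally show ?thesis .
qed

text \<open>Given the positions of the first k selected labels, the fitnesses at these positions are
  only conditioned to exceed f, since the remaining constraints on the positions involve
  other variables.\<close>

lemma (in prob_space) selected_fitness_rectangle: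
  fixes W :: "idx \<Rightarrow> 'a \<Rightarrow> real"
  assumes ind: "indep_vars (\<lambda>_. borel) W UNIV"
    and unif: "\<And>n k. distr M borel (W (IU n k)) = uniform_measure lborel {0..1}"
    and f: "0 \<le> f" "f < 1"
    and B: "\<And>i. B i \<in> sets borel"
    and vs: "length vs = k"
  defines "pos \<equiv> {\<omega>\<in>space M. \<forall>i<k. sel_index f i (\<lambda>j. W j \<omega>) = Some (vs ! i)}"
  shows "prob (pos \<inter> {\<omega>\<in>space M. \<forall>i<k. nth_fitness f i (\<lambda>j. W j \<omega>) \<in> B i})
    = (\<Prod>i<k. measure (uniform_measure lborel {f..1}) (B i)) * prob pos"
proof (cases "distinct vs")
  case False
  then obtain i j where "i < k" "j < k" "i \<noteq> j" "vs ! i = vs ! j"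
    using vs by (auto simp: distinct_conv_nth)
  then have "pos = {}" unfolding pos_def by (auto simp: sel_index_eq_Some_iff) (metis)
  then show ?thesis by simp
next
  case True
  have W [measurable]: "W j \<in> borel_measurable M" for j
    using ind by (auto simp: indep_vars_def2)
  define iu where "iu i = IU (fst (vs ! i)) (snd (vs ! i))" for i
  define J where "J = iu ` {..<k}"
  have iu_inj: "iu i = iu j \<longleftrightarrow> i = j" if "i < k" "j < k" for i j
    using that True vs by (auto simp: iu_def nth_eq_iff_index_eq prod_eq_iff[symmetric])
  define K where "K = (\<lambda>l. case l of None \<Rightarrow> - J | Some i \<Rightarrow> {iu i})"
  define L where "L = insert None (Some ` {..<k})"
  have indK: "indep_vars (\<lambda>l. PiM (K l) (\<lambda>_. borel)) (\<lambda>l \<omega>. restrict (\<lambda>j. W j \<omega>) (K l)) L"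
    using iu_inj by (intro indep_vars_restrict[OF ind])
      (auto simp: disjoint_family_on_def L_def K_def J_def)
  define E where "E = {x \<in> space (PiM (- J) (\<lambda>_. borel)).
      \<forall>i<k. vs ! i \<in> sel (set vs) f x \<and> lex_rank (sel (set vs) f x) (vs ! i) = i}"
  have comp: "(\<lambda>x. x j) \<in> borel_measurable (PiM (- J) (\<lambda>_. borel :: real measure))" for j
  proof (cases "j \<in> - J")
    case False
    then have "(\<lambda>x. x j) \<in> borel_measurable (PiM (- J) (\<lambda>_. borel :: real measure))
        \<longleftrightarrow> (\<lambda>x. undefined :: real) \<in> borel_measurable (PiM (- J) (\<lambda>_. borel :: real measure))"
      by (intro measurable_cong) (auto simp: space_PiM PiE_def extensional_def)
    then show ?thesis by simp
  qed auto
  have E: "E \<in> sets (PiM (- J) (\<lambda>_. borel))"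
  proof -
    have "E = space (PiM (- J) (\<lambda>_. borel)) \<inter> (\<Inter>i\<in>{..<k}. {x \<in> space (PiM (- J) (\<lambda>_. borel)).
        vs ! i \<in> sel (set vs) f x \<and> lex_rank (sel (set vs) f x) (vs ! i) = i})"
      unfolding E_def by auto
    also have "\<dots> \<in> sets (PiM (- J) (\<lambda>_. borel))"
      by (cases "k = 0") (auto intro!: sets.Int sets.finite_INT pred_lex_rank_sel[OF comp])
    finally show ?thesis .
  qed
  have iuJ: "IU (fst v) (snd v) \<in> J \<longleftrightarrow> v \<in> set vs" for v
    unfolding J_def iu_def using vs by (force simp: in_set_conv_nth prod_eq_iff)
  have noJ: "IC n \<notin> J" "IZ n \<notin> J" for n unfolding J_def iu_def by auto
  have sel_restrict: "sel (set vs) f (restrict w (- J)) = sel (set vs) f w" for w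
    unfolding sel_def using iuJ noJ by auto
  have pos_iff: "\<omega> \<in> pos \<longleftrightarrow> (\<forall>i<k. f < W (iu i) \<omega>) \<and> restrict (\<lambda>j. W j \<omega>) (- J) \<in> E"
    if "\<omega> \<in> space M" for \<omega>
  proof -
    have "(\<forall>i<k. f < W (iu i) \<omega>) \<Longrightarrow> sel (set vs) f (\<lambda>j. W j \<omega>) = sel {} f (\<lambda>j. W j \<omega>)"
      unfolding sel_def using vs by (auto simp: iu_def in_set_conv_nth)
    moreover have "\<omega> \<in> pos \<Longrightarrow> (\<forall>i<k. f < W (iu i) \<omega>)"
      unfolding pos_def sel_index_eq_Some_iff by (auto simp: sel_def iu_def)
    moreover have "restrict (\<lambda>j. W j \<omega>) (- J) \<in> space (PiM (- J) (\<lambda>_. borel))"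
      by (auto simp: space_PiM)
    ultimately show ?thesis
      using that unfolding E_def pos_def sel_index_eq_Some_iff by (auto simp: sel_restrict)
  qed
  have rect: "prob (pos \<inter> {\<omega>\<in>space M. \<forall>i<k. nth_fitness f i (\<lambda>j. W j \<omega>) \<in> B i})
      = (\<Prod>i<k. measure (uniform_measure lborel {f..1}) (B i))
        * ((1 - f) ^ k * prob ((\<lambda>\<omega>. restrict (\<lambda>j. W j \<omega>) (- J)) -` E \<inter> space M))"
    if B: "\<And>i. B i \<in> sets borel" for B
  proof -
    define C where "C = (\<lambda>l. case l of None \<Rightarrow> E
      | Some i \<Rightarrow> (\<lambda>x. x (iu i)) -` (B i \<inter> {f<..}) \<inter> space (PiM (K (Some i)) (\<lambda>_. borel)))"
    have C: "C l \<in> sets (PiM (K l) (\<lambda>_. borel))" for l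
    proof (cases l)
      case None
      then show ?thesis using E by (simp add: C_def K_def)
    next
      case (Some i)
      have "(\<lambda>x. x (iu i)) \<in> borel_measurable (PiM (K (Some i)) (\<lambda>_. borel :: real measure))"
        by (rule measurable_component_singleton) (simp add: K_def)
      then show ?thesis using B[of i] Some by (auto simp: C_def intro!: measurable_sets)
    qed
    have CS: "(\<lambda>\<omega>. restrict (\<lambda>j. W j \<omega>) (K (Some i))) -` C (Some i) \<inter> space M
        = W (iu i) -` (B i \<inter> {f<..}) \<inter> space M" for i
      by (auto simp: C_def K_def space_PiM)
    have fit: "nth_fitness f i (\<lambda>j. W j \<omega>) = W (iu i) \<omega>" if "\<omega> \<in> pos" "i < k" for i \<omega>
      using that by (simp add: pos_def nth_fitness_def iu_def)
    have "pos \<inter> {\<omega>\<in>space M. \<forall>i<k. nth_fitness f i (\<lambda>j. W j \<omega>) \<in> B i}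
        = {\<omega>\<in>space M. restrict (\<lambda>j. W j \<omega>) (- J) \<in> E \<and> (\<forall>i<k. W (iu i) \<omega> \<in> B i \<inter> {f<..})}"
    proof (intro set_eqI iffI)
      fix \<omega> assume "\<omega> \<in> pos \<inter> {\<omega>\<in>space M. \<forall>i<k. nth_fitness f i (\<lambda>j. W j \<omega>) \<in> B i}"
      then show "\<omega> \<in> {\<omega>\<in>space M. restrict (\<lambda>j. W j \<omega>) (- J) \<in> E \<and> (\<forall>i<k. W (iu i) \<omega> \<in> B i \<inter> {f<..})}"
        using pos_iff fit by auto
    next
      fix \<omega> assume *: "\<omega> \<in> {\<omega>\<in>space M. restrict (\<lambda>j. W j \<omega>) (- J) \<in> E \<and> (\<forall>i<k. W (iu i) \<omega> \<in> B i \<inter> {f<..})}"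
      then have "\<omega> \<in> pos" using pos_iff by auto
      with * show "\<omega> \<in> pos \<inter> {\<omega>\<in>space M. \<forall>i<k. nth_fitness f i (\<lambda>j. W j \<omega>) \<in> B i}"
        using fit by auto
    qed
    also have "\<dots> = (\<Inter>l\<in>L. (\<lambda>\<omega>. restrict (\<lambda>j. W j \<omega>) (K l)) -` C l \<inter> space M)"
      unfolding L_def by (simp add: CS image_image) (auto simp: C_def K_def)
    finally have "prob (pos \<inter> {\<omega>\<in>space M. \<forall>i<k. nth_fitness f i (\<lambda>j. W j \<omega>) \<in> B i})
        = (\<Prod>l\<in>L. prob ((\<lambda>\<omega>. restrict (\<lambda>j. W j \<omega>) (K l)) -` C l \<inter> space M))"
      using indep_varsD[OF indK, of L C] C by (simp add: L_def)
    also have "\<dots> = prob ((\<lambda>\<omega>. restrict (\<lambda>j. W j \<omega>) (- J)) -` E \<inter> space M)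
        * (\<Prod>i<k. prob (W (iu i) -` (B i \<inter> {f<..}) \<inter> space M))"
      unfolding L_def by (subst prod.insert) (auto simp: prod.reindex CS, simp add: K_def C_def)
    also have "(\<Prod>i<k. prob (W (iu i) -` (B i \<inter> {f<..}) \<inter> space M))
        = (\<Prod>i<k. (1 - f) * measure (uniform_measure lborel {f..1}) (B i))"
    proof (rule prod.cong)
      fix i
      have "prob (W (iu i) -` (B i \<inter> {f<..}) \<inter> space M) = measure (distr M borel (W (iu i))) (B i \<inter> {f<..})"
        using B by (subst measure_distr) auto
      also have "\<dots> = (1 - f) * measure (uniform_measure lborel {f..1}) (B i)"
        using measure_uniform_above[OF f B] unif by (simp add: iu_def)
      finally show "prob (W (iu i) -` (B i \<inter> {f<..}) \<inter> space M)
        = (1 - f) * measure (uniform_measure lborel {f..1}) (B i)" .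
    qed simp
    finally show ?thesis unfolding prod.distrib by (simp only: prod_constant card_lessThan mult_ac)
  qed
  interpret F: prob_space "uniform_measure lborel {f..1}"
    using f by (intro prob_space_uniform_measure) auto
  have "measure (uniform_measure lborel {f..1}) UNIV = 1" using F.prob_space by simp
  then have "prob pos = (1 - f) ^ k * prob ((\<lambda>\<omega>. restrict (\<lambda>j. W j \<omega>) (- J)) -` E \<inter> space M)"
    using rect[of "\<lambda>_. UNIV"] by (simp add: pos_def Int_def cong: conj_cong)
  with rect[OF B] show ?thesis by simp
qed

theorem (in prob_space) selected_fitness_iid:
  fixes W :: "idx \<Rightarrow> 'a \<Rightarrow> real"
  assumes ind: "indep_vars (\<lambda>_. borel) W UNIV"
    and unif: "\<And>n k. distr M borel (W (IU n k)) = uniform_measure lborel {0..1}"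
    and f: "0 \<le> f" "f < 1"
    and ex: "AE \<omega> in M. \<forall>i. sel_index f i (\<lambda>j. W j \<omega>) \<noteq> None"
  shows "indep_vars (\<lambda>_. borel) (\<lambda>i \<omega>. nth_fitness f i (\<lambda>j. W j \<omega>)) UNIV"
    and "distr M borel (\<lambda>\<omega>. nth_fitness f i (\<lambda>j. W j \<omega>)) = uniform_measure lborel {f..1}"
proof -
  let ?F = "uniform_measure lborel {f..1}"
  have W [measurable]: "W j \<in> borel_measurable M" for j
    using ind by (auto simp: indep_vars_def2)
  have Y [measurable]: "(\<lambda>\<omega>. nth_fitness f i (\<lambda>j. W j \<omega>)) \<in> borel_measurable M" for i
    by (rule measurable_nth_fitness) simp
  interpret F: prob_space ?F
    using f by (intro prob_space_uniform_measure) auto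
  have rect: "prob {\<omega>\<in>space M. \<forall>i<k. nth_fitness f i (\<lambda>j. W j \<omega>) \<in> B i} = (\<Prod>i<k. measure ?F (B i))"
    if B [measurable]: "\<And>i. B i \<in> sets borel" for k B
  proof -
    let ?c = "\<Prod>i<k. measure ?F (B i)"
    define pos where "pos vs = {\<omega>\<in>space M. \<forall>i<k. sel_index f i (\<lambda>j. W j \<omega>) = Some (vs ! i)}" for vs
    define G where "G = {\<omega>\<in>space M. \<forall>i<k. nth_fitness f i (\<lambda>j. W j \<omega>) \<in> B i}"
    let ?L = "{vs :: (nat \<times> nat) list. length vs = k}"
    have pos [measurable]: "pos vs \<in> events" for vs
    proof -
      have "pos vs = space M \<inter> (\<Inter>i\<in>{..<k}. {\<omega>\<in>space M. vs ! i \<in> sel {} f (\<lambda>j. W j \<omega>)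
          \<and> lex_rank (sel {} f (\<lambda>j. W j \<omega>)) (vs ! i) = i})"
        unfolding pos_def sel_index_eq_Some_iff by auto
      also have "\<dots> \<in> events"
        by (cases "k = 0") (auto intro!: sets.Int sets.finite_INT pred_lex_rank_sel)
      finally show ?thesis .
    qed
    have G [measurable]: "G \<in> events" unfolding G_def by measurable
    have disj: "disjoint_family_on pos ?L"
      unfolding disjoint_family_on_def pos_def by (auto simp: list_eq_iff_nth_eq)
    have count: "countable ?L" by simp
    have full: "AE \<omega> in M. \<omega> \<in> (\<Union>vs\<in>?L. pos vs)"
      using ex AE_space
    proof eventually_elim
      case (elim \<omega>)
      then have "\<omega> \<in> pos (map (\<lambda>i. the (sel_index f i (\<lambda>j. W j \<omega>))) [0..<k])"
        unfolding pos_def by auto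
      then show ?case by force
    qed
    have sum: "emeasure M A = (\<integral>\<^sup>+vs. emeasure M (pos vs \<inter> A) \<partial>count_space ?L)" if [measurable]: "A \<in> events" for A
    proof -
      have "emeasure M A = emeasure M (\<Union>vs\<in>?L. pos vs \<inter> A)"
      proof (rule emeasure_eq_AE)
        show "AE \<omega> in M. \<omega> \<in> A \<longleftrightarrow> \<omega> \<in> (\<Union>vs\<in>?L. pos vs \<inter> A)"
          using full by eventually_elim auto
        show "(\<Union>vs\<in>?L. pos vs \<inter> A) \<in> events"
          by (intro sets.countable_UN' count) auto
      qed simp
      also have "\<dots> = (\<integral>\<^sup>+vs. emeasure M (pos vs \<inter> A) \<partial>count_space ?L)"
        using disj by (intro emeasure_UN_countable count) (auto simp: disjoint_family_on_def)
      finally show ?thesis .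
    qed
    have "emeasure M G = (\<integral>\<^sup>+vs. emeasure M (pos vs \<inter> G) \<partial>count_space ?L)"
      by (rule sum) simp
    also have "\<dots> = (\<integral>\<^sup>+vs. ennreal ?c * emeasure M (pos vs \<inter> space M) \<partial>count_space ?L)"
    proof (rule nn_integral_cong)
      fix vs assume "vs \<in> space (count_space ?L)"
      then have *: "prob (pos vs \<inter> G) = ?c * prob (pos vs)"
        unfolding pos_def G_def by (intro selected_fitness_rectangle[OF ind unif f B]) simp
      have "pos vs \<inter> space M = pos vs" unfolding pos_def by blast
      then show "emeasure M (pos vs \<inter> G) = ennreal ?c * emeasure M (pos vs \<inter> space M)"
        unfolding emeasure_eq_measure * by (simp only: ennreal_mult prod_nonneg measure_nonneg)
    qed
    also have "\<dots> = ennreal ?c * emeasure M (space M)"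
      using sum[OF sets.top] by (subst nn_integral_cmult) simp_all
    finally have "ennreal (prob G) = ennreal ?c"
      unfolding emeasure_space_1 unfolding emeasure_eq_measure by simp
    then show ?thesis
      unfolding G_def by (subst (asm) ennreal_inj) (auto intro: prod_nonneg)
  qed
  have sets: "sets ?F = sets borel" by simp
  note iid = iid_from_rectangles[OF Y F.prob_space_axioms sets]
  show "indep_vars (\<lambda>_. borel) (\<lambda>i \<omega>. nth_fitness f i (\<lambda>j. W j \<omega>)) UNIV"
    by (rule iid(1)) (rule rect)
  show "distr M borel (\<lambda>\<omega>. nth_fitness f i (\<lambda>j. W j \<omega>)) = ?F"
    by (rule iid(2)) (rule rect)
qed

section \<open>Averages of the driving variables\<close>

locale evolution_model = prob_space M for M :: "'a measure" +
  fixes Xs Zs :: "nat \<Rightarrow> 'a \<Rightarrow> nat"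
    and C :: "nat \<Rightarrow> 'a \<Rightarrow> bool"
    and U :: "nat \<Rightarrow> nat \<Rightarrow> 'a \<Rightarrow> real"
    and p :: real
  assumes p: "0 < p" "p < 1"
    and Xmeas [measurable]: "\<And>n. Xs n \<in> measurable M (count_space UNIV)"
    and Zmeas [measurable]: "\<And>n. Zs n \<in> measurable M (count_space UNIV)"
    and Cmeas [measurable]: "\<And>n. C n \<in> measurable M (count_space UNIV)"
    and Xid: "\<And>n. distr M (count_space UNIV) (Xs n) = distr M (count_space UNIV) (Xs 0)"
    and Zid: "\<And>n. distr M (count_space UNIV) (Zs n) = distr M (count_space UNIV) (Zs 0)"
    and Cp: "\<And>n. measure M {\<omega> \<in> space M. C n \<omega>} = p"
    and Uunif: "\<And>n k. distr M borel (U n k) = uniform_measure lborel {0..1}"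
    and indep: "indep_vars (\<lambda>_. borel)
                  (\<lambda>i \<omega>. case i of IX n \<Rightarrow> real (Xs n \<omega>) | IZ n \<Rightarrow> real (Zs n \<omega>)
                                | IC n \<Rightarrow> (if C n \<omega> then 1 else 0) | IU n k \<Rightarrow> U n k \<omega>) UNIV"
begin

definition W :: "idx \<Rightarrow> 'a \<Rightarrow> real" where
  "W = (\<lambda>i \<omega>. case i of IX n \<Rightarrow> real (Xs n \<omega>) | IZ n \<Rightarrow> real (Zs n \<omega>)
                                | IC n \<Rightarrow> (if C n \<omega> then 1 else 0) | IU n k \<Rightarrow> U n k \<omega>)"

lemma W_simps [simp]:
  "W (IX n) \<omega> = real (Xs n \<omega>)" "W (IZ n) \<omega> = real (Zs n \<omega>)"
  "W (IC n) \<omega> = (if C n \<omega> then 1 else 0)" "W (IU n k) = U n k"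
  by (auto simp: W_def)

lemma indep_W: "indep_vars (\<lambda>_. borel) W UNIV"
  using indep unfolding W_def .

lemma measurable_W [measurable]: "W i \<in> borel_measurable M"
  using indep_W by (auto simp: indep_vars_def2)

lemma measurable_U [measurable]: "U n k \<in> borel_measurable M"
  using measurable_W[of "IU n k"] by simp

lemma indep_var_W:
  assumes "a \<noteq> b"
  shows "indep_var borel (W a) borel (W b)"
proof -
  have "indep_vars (\<lambda>_. borel) (\<lambda>t. W (case_bool a b t)) UNIV"
    using indep_vars_reindex[OF indep_W, of "case_bool a b" UNIV] assms
    by (auto simp: inj_def split: bool.splits)
  moreover have "(\<lambda>t. W (case_bool a b t)) = case_bool (W a) (W b)" "(\<lambda>_. borel) = case_bool borel borel"
    by (auto split: bool.split)
  ultimately show ?thesis unfolding indep_var_def by metis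
qed

fun row_index :: "nat \<Rightarrow> nat \<Rightarrow> idx" where
  "row_index n 0 = IX n"
| "row_index n (Suc 0) = IZ n"
| "row_index n (Suc (Suc 0)) = IC n"
| "row_index n (Suc (Suc (Suc k))) = IU n k"

lemma row_index_inj: "row_index n j = row_index m k \<longleftrightarrow> n = m \<and> j = k"
  by (cases "(n, j)" rule: row_index.cases; cases "(m, k)" rule: row_index.cases) auto

definition row :: "nat \<Rightarrow> 'a \<Rightarrow> nat \<Rightarrow> real" where
  "row n \<omega> j = W (row_index n j) \<omega>"

lemma indep_row: "indep_vars (\<lambda>_. PiM UNIV (\<lambda>_. borel)) row UNIV"
proof -
  have "indep_vars (\<lambda>n. PiM (range (row_index n)) (\<lambda>_. borel))
      (\<lambda>n \<omega>. restrict (\<lambda>i. W i \<omega>) (range (row_index n))) UNIV"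
    by (intro indep_vars_restrict[OF indep_W]) (auto simp: disjoint_family_on_def row_index_inj)
  then have "indep_vars (\<lambda>_. PiM UNIV (\<lambda>_. borel))
      (\<lambda>n \<omega>. (\<lambda>x j. x (row_index n j)) (restrict (\<lambda>i. W i \<omega>) (range (row_index n)))) UNIV"
    by (rule indep_vars_compose2)
       (auto intro!: measurable_PiM_single' measurable_component_singleton simp: space_PiM)
  then show ?thesis by (simp add: row_def[abs_def])
qed

lemma prob_not_coin: "prob {\<omega> \<in> space M. \<not> C n \<omega>} = 1 - p"
  using prob_neg[of "C n"] Cp by simp

lemma distr_coin: "distr M (count_space UNIV) (C n) = distr M (count_space UNIV) (C 0)"
proof (rule measure_eqI_finite[of _ UNIV])
  show "emeasure (distr M (count_space UNIV) (C n)) {a} = emeasure (distr M (count_space UNIV) (C 0)) {a}" for a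
    using Cp prob_not_coin by (cases a) (simp_all add: emeasure_distr emeasure_eq_measure vimage_def Int_def conj_commute)
qed auto

lemma distr_row_index: "distr M borel (W (row_index n j)) = distr M borel (W (row_index 0 j))"
proof -
  have *: "distr M borel (\<lambda>\<omega>. h (V \<omega>)) = distr (distr M (count_space UNIV) V) borel h"
    if "V \<in> measurable M (count_space UNIV)" for V :: "'a \<Rightarrow> 'b" and h :: "'b \<Rightarrow> real"
    using that by (subst distr_distr) (auto simp: comp_def)
  have X: "W (IX n) = (\<lambda>\<omega>. real (Xs n \<omega>))" and Z: "W (IZ n) = (\<lambda>\<omega>. real (Zs n \<omega>))"
    and C: "W (IC n) = (\<lambda>\<omega>. if C n \<omega> then 1 else 0)" for n
    by auto
  show ?thesis
  proof (cases "(n, j)" rule: row_index.cases)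
    case (1 m)
    have "distr M borel (W (IX n)) = distr M borel (W (IX 0))"
      unfolding X *[OF Xmeas, of real] Xid[of n] ..
    with 1 show ?thesis by simp
  next
    case (2 m)
    have "distr M borel (W (IZ n)) = distr M borel (W (IZ 0))"
      unfolding Z *[OF Zmeas, of real] Zid[of n] ..
    with 2 show ?thesis by simp
  next
    case (3 m)
    have "distr M borel (W (IC n)) = distr M borel (W (IC 0))"
      unfolding C *[OF Cmeas, of "\<lambda>b. if b then 1 else 0"] distr_coin[of n] ..
    with 3 show ?thesis by simp
  next
    case (4 m k)
    then show ?thesis using Uunif by simp
  qed
qed

lemma distr_row: "distr M (PiM UNIV (\<lambda>_. borel)) (row n) = distr M (PiM UNIV (\<lambda>_. borel)) (row 0)"
proof -
  have "distr M (PiM UNIV (\<lambda>_. borel)) (row n) = (\<Pi>\<^sub>M j\<in>UNIV. distr M borel (W (row_index n j)))" for n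
  proof -
    have "indep_vars (\<lambda>_. borel) (\<lambda>j. W (row_index n j)) UNIV"
      using indep_vars_reindex[OF indep_W, of "row_index n" UNIV] by (simp add: inj_def row_index_inj)
    then have "distr M (PiM UNIV (\<lambda>_. borel)) (\<lambda>\<omega>. \<lambda>j\<in>UNIV. W (row_index n j) \<omega>)
        = (\<Pi>\<^sub>M j\<in>UNIV. distr M borel (W (row_index n j)))"
      by (subst (asm) indep_vars_iff_distr_eq_PiM') auto
    then show ?thesis by (simp add: row_def[abs_def] restrict_UNIV)
  qed
  then show ?thesis using distr_row_index[of n] by (metis (no_types, lifting) PiM_cong)
qed

lemma row_law_of_large_numbers:
  assumes G [measurable]: "G \<in> borel_measurable (PiM UNIV (\<lambda>_. borel))"
    and int: "integrable M (\<lambda>\<omega>. G (row 0 \<omega>))"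
  shows "AE \<omega> in M. (\<lambda>n. (\<Sum>i<n. G (row i \<omega>)) / real n) \<longlonglongrightarrow> expectation (\<lambda>\<omega>. G (row 0 \<omega>))"
proof (rule strong_law_of_large_numbers)
  show "indep_vars (\<lambda>_. borel) (\<lambda>n \<omega>. G (row n \<omega>)) UNIV"
    by (rule indep_vars_compose2[OF indep_row]) simp
  have [measurable]: "row n \<in> measurable M (PiM UNIV (\<lambda>_. borel))" for n
    using indep_row by (auto simp: indep_vars_def2)
  have "distr M borel (\<lambda>\<omega>. G (row n \<omega>)) = distr (distr M (PiM UNIV (\<lambda>_. borel)) (row n)) borel G" for n
    by (subst distr_distr) (auto simp: comp_def)
  then show "distr M borel (\<lambda>\<omega>. G (row n \<omega>)) = distr M borel (\<lambda>\<omega>. G (row 0 \<omega>))" for n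
    using distr_row[of n] by simp
qed (rule int)

lemma expectation_coin_mult:
  fixes V :: "'a \<Rightarrow> nat" and h :: "nat \<Rightarrow> real" and t :: "bool \<Rightarrow> real"
  assumes V: "a \<noteq> IC 0" "W a = (\<lambda>\<omega>. real (V \<omega>))"
    and int: "integrable M (\<lambda>\<omega>. h (V \<omega>))"
  shows "integrable M (\<lambda>\<omega>. t (C 0 \<omega>) * h (V \<omega>))"
    and "expectation (\<lambda>\<omega>. t (C 0 \<omega>) * h (V \<omega>)) = (p * t True + (1 - p) * t False) * expectation (\<lambda>\<omega>. h (V \<omega>))"
proof -
  let ?g = "\<lambda>r :: real. if r = 1 then t True else t False" and ?k = "\<lambda>r :: real. h (nat \<lfloor>r\<rfloor>)"
  have "indep_var borel (?g \<circ> W (IC 0)) borel (?k \<circ> W a)"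
    by (rule indep_var_compose[OF indep_var_W]) (use V in auto)
  moreover have "?g \<circ> W (IC 0) = (\<lambda>\<omega>. t (C 0 \<omega>))" by (auto simp: fun_eq_iff)
  moreover have "?k \<circ> W a = (\<lambda>\<omega>. h (V \<omega>))" using V by (auto simp: fun_eq_iff)
  ultimately have iv: "indep_var borel (\<lambda>\<omega>. t (C 0 \<omega>)) borel (\<lambda>\<omega>. h (V \<omega>))" by simp
  have eq: "t (C 0 \<omega>) = t True * indicator {\<omega> \<in> space M. C 0 \<omega>} \<omega> + t False * indicator {\<omega> \<in> space M. \<not> C 0 \<omega>} \<omega>"
    if "\<omega> \<in> space M" for \<omega> using that by (cases "C 0 \<omega>") auto
  have it: "integrable M (\<lambda>\<omega>. t (C 0 \<omega>))"
  proof (rule integrable_const_bound[of _ "\<bar>t True\<bar> + \<bar>t False\<bar>"])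
    have "\<bar>t b\<bar> \<le> \<bar>t True\<bar> + \<bar>t False\<bar>" for b by (cases b) auto
    then show "AE \<omega> in M. norm (t (C 0 \<omega>)) \<le> \<bar>t True\<bar> + \<bar>t False\<bar>" by simp
  qed measurable
  have "expectation (\<lambda>\<omega>. t (C 0 \<omega>)) = p * t True + (1 - p) * t False"
  proof -
    have ev: "{\<omega> \<in> space M. C 0 \<omega>} \<in> events" "{\<omega> \<in> space M. \<not> C 0 \<omega>} \<in> events" by measurable
    have "integrable M (\<lambda>\<omega>. t True * indicator {\<omega> \<in> space M. C 0 \<omega>} \<omega>)"
      "integrable M (\<lambda>\<omega>. t False * indicator {\<omega> \<in> space M. \<not> C 0 \<omega>} \<omega>)"
      using ev by (auto intro!: integrable_mult_right integrable_real_indicator simp: emeasure_eq_measure)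
    moreover have "expectation (\<lambda>\<omega>. t (C 0 \<omega>)) = expectation (\<lambda>\<omega>. t True * indicator {\<omega> \<in> space M. C 0 \<omega>} \<omega>
        + t False * indicator {\<omega> \<in> space M. \<not> C 0 \<omega>} \<omega>)"
      by (rule Bochner_Integration.integral_cong[OF refl eq])
    moreover have "{\<omega> \<in> space M. P \<omega>} \<inter> space M = {\<omega> \<in> space M. P \<omega>}" for P by blast
    ultimately show ?thesis
      by (simp add: Cp prob_not_coin)
  qed
  then show "integrable M (\<lambda>\<omega>. t (C 0 \<omega>) * h (V \<omega>))"
    "expectation (\<lambda>\<omega>. t (C 0 \<omega>) * h (V \<omega>)) = (p * t True + (1 - p) * t False) * expectation (\<lambda>\<omega>. h (V \<omega>))"
    using indep_var_integrable[OF iv it int] indep_var_lebesgue_integral[OF iv it int] by auto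
qed

lemma average_additions:
  fixes h :: "nat \<Rightarrow> real"
  assumes "integrable M (\<lambda>\<omega>. h (Zs 0 \<omega>))"
  shows "AE \<omega> in M. (\<lambda>n. (\<Sum>i<n. if C i \<omega> then h (Zs i \<omega>) else 0) / real n)
    \<longlonglongrightarrow> p * expectation (\<lambda>\<omega>. h (Zs 0 \<omega>))"
proof -
  let ?G = "\<lambda>r :: nat \<Rightarrow> real. if r 2 = 1 then h (nat \<lfloor>r 1\<rfloor>) else 0"
  have meas: "?G \<in> borel_measurable (PiM UNIV (\<lambda>_. borel))" by measurable
  have G: "?G (row i \<omega>) = (if C i \<omega> then h (Zs i \<omega>) else 0)" for i \<omega>
    by (simp add: row_def numeral_2_eq_2)
  have e: "(\<lambda>\<omega>. if C 0 \<omega> then h (Zs 0 \<omega>) else 0) = (\<lambda>\<omega>. of_bool (C 0 \<omega>) * h (Zs 0 \<omega>))" by auto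
  have I: "IZ 0 \<noteq> IC 0" "W (IZ 0) = (\<lambda>\<omega>. real (Zs 0 \<omega>))" by auto
  note E = expectation_coin_mult[of "IZ 0" "Zs 0" h, OF I assms, of of_bool]
  have "integrable M (\<lambda>\<omega>. ?G (row 0 \<omega>))" unfolding G e by (rule E(1))
  moreover have "expectation (\<lambda>\<omega>. ?G (row 0 \<omega>)) = p * expectation (\<lambda>\<omega>. h (Zs 0 \<omega>))"
    unfolding G e using E(2) by simp
  ultimately show ?thesis
    using row_law_of_large_numbers[OF meas] by (simp only: G)
qed

lemma average_removals:
  fixes h :: "nat \<Rightarrow> real"
  assumes "integrable M (\<lambda>\<omega>. h (Xs 0 \<omega>))"
  shows "AE \<omega> in M. (\<lambda>n. (\<Sum>i<n. if C i \<omega> then 0 else h (Xs i \<omega>)) / real n)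
    \<longlonglongrightarrow> (1 - p) * expectation (\<lambda>\<omega>. h (Xs 0 \<omega>))"
proof -
  let ?G = "\<lambda>r :: nat \<Rightarrow> real. if r 2 = 1 then 0 else h (nat \<lfloor>r 0\<rfloor>)"
  have meas: "?G \<in> borel_measurable (PiM UNIV (\<lambda>_. borel))" by measurable
  have G: "?G (row i \<omega>) = (if C i \<omega> then 0 else h (Xs i \<omega>))" for i \<omega>
    by (simp add: row_def numeral_2_eq_2)
  have e: "(\<lambda>\<omega>. if C 0 \<omega> then 0 else h (Xs 0 \<omega>)) = (\<lambda>\<omega>. of_bool (\<not> C 0 \<omega>) * h (Xs 0 \<omega>))" by auto
  have I: "IX 0 \<noteq> IC 0" "W (IX 0) = (\<lambda>\<omega>. real (Xs 0 \<omega>))" by auto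
  note E = expectation_coin_mult[of "IX 0" "Xs 0" h, OF I assms, of "\<lambda>b. of_bool (\<not> b)"]
  have "integrable M (\<lambda>\<omega>. ?G (row 0 \<omega>))" unfolding G e by (rule E(1))
  moreover have "expectation (\<lambda>\<omega>. ?G (row 0 \<omega>)) = (1 - p) * expectation (\<lambda>\<omega>. h (Xs 0 \<omega>))"
    unfolding G e using E(2) by simp
  ultimately show ?thesis
    using row_law_of_large_numbers[OF meas] by (simp only: G)
qed

lemma prob_fitness_le:
  assumes "0 \<le> f" "f \<le> 1"
  shows "prob {\<omega> \<in> space M. U n k \<omega> \<le> f} = f"
proof -
  have "prob {\<omega> \<in> space M. U n k \<omega> \<le> f} = measure (distr M borel (U n k)) {..f}"
    by (subst measure_distr) (auto simp: vimage_def Int_def conj_commute)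
  also have "\<dots> = measure lborel ({0..1} \<inter> {..f})"
    unfolding Uunif by (subst measure_uniform_measure) auto
  also have "{0..1} \<inter> {..f} = {0..f}" using assms by auto
  finally show ?thesis using assms by simp
qed

lemma nn_integral_low_additions:
  assumes f: "0 \<le> f" "f \<le> 1"
  shows "(\<integral>\<^sup>+\<omega>. of_nat (if C 0 \<omega> then card {k. k < Zs 0 \<omega> \<and> U 0 k \<omega> \<le> f} else 0) \<partial>M)
    = ennreal (p * f) * (\<integral>\<^sup>+\<omega>. of_nat (Zs 0 \<omega>) \<partial>M)"
proof -
  define E where "E k = {\<omega> \<in> space M. C 0 \<omega> \<and> k < Zs 0 \<omega> \<and> U 0 k \<omega> \<le> f}" for k
  have [measurable]: "E k \<in> events" for k unfolding E_def by measurable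
  have "(\<Sum>k. indicator (E k) \<omega>) = (of_nat (if C 0 \<omega> then card {k. k < Zs 0 \<omega> \<and> U 0 k \<omega> \<le> f} else 0) :: ennreal)"
    if "\<omega> \<in> space M" for \<omega>
  proof -
    let ?K = "{k. C 0 \<omega> \<and> k < Zs 0 \<omega> \<and> U 0 k \<omega> \<le> f}"
    have "(\<Sum>k. indicator (E k) \<omega> :: ennreal) = (\<Sum>k\<in>?K. indicator (E k) \<omega>)"
      by (rule suminf_finite) (auto simp: E_def)
    also have "\<dots> = (\<Sum>k\<in>?K. 1)" using that by (intro sum.cong) (auto simp: E_def)
    finally show ?thesis by auto
  qed
  then have "(\<integral>\<^sup>+\<omega>. of_nat (if C 0 \<omega> then card {k. k < Zs 0 \<omega> \<and> U 0 k \<omega> \<le> f} else 0) \<partial>M)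
      = (\<integral>\<^sup>+\<omega>. (\<Sum>k. indicator (E k) \<omega>) \<partial>M)"
    by (intro nn_integral_cong) simp
  also have "\<dots> = (\<Sum>k. emeasure M (E k))" by (subst nn_integral_suminf) auto
  also have "\<dots> = (\<Sum>k. ennreal (p * f) * emeasure M {\<omega> \<in> space M. k < Zs 0 \<omega>})"
  proof (rule suminf_cong)
    fix k
    let ?A = "\<lambda>i. case i of IC _ \<Rightarrow> {1} | IZ _ \<Rightarrow> {real k<..} | IU _ _ \<Rightarrow> {..f} | IX _ \<Rightarrow> UNIV"
    have "E k = (\<Inter>i\<in>{IC 0, IZ 0, IU 0 k}. W i -` ?A i \<inter> space M)"
      unfolding E_def by (auto split: if_splits)
    moreover have "?A i \<in> sets borel" for i :: idx by (cases i) auto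
    ultimately have "prob (E k) = (\<Prod>i\<in>{IC 0, IZ 0, IU 0 k}. prob (W i -` ?A i \<inter> space M))"
      using indep_varsD[OF indep_W, of "{IC 0, IZ 0, IU 0 k}" ?A] by simp
    also have "\<dots> = prob (W (IC 0) -` {1} \<inter> space M) * (prob (W (IZ 0) -` {real k<..} \<inter> space M)
        * prob (W (IU 0 k) -` {..f} \<inter> space M))" by simp
    also have "W (IC 0) -` {1} \<inter> space M = {\<omega> \<in> space M. C 0 \<omega>}" by (auto split: if_splits)
    also have "W (IZ 0) -` {real k<..} \<inter> space M = {\<omega> \<in> space M. k < Zs 0 \<omega>}" by auto
    also have "W (IU 0 k) -` {..f} \<inter> space M = {\<omega> \<in> space M. U 0 k \<omega> \<le> f}" by auto
    finally have "prob (E k) = (p * f) * prob {\<omega> \<in> space M. k < Zs 0 \<omega>}"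
      using prob_fitness_le[OF f] Cp by simp
    then show "emeasure M (E k) = ennreal (p * f) * emeasure M {\<omega> \<in> space M. k < Zs 0 \<omega>}"
      using p f unfolding emeasure_eq_measure by (simp add: ennreal_mult)
  qed
  also have "\<dots> = ennreal (p * f) * (\<integral>\<^sup>+\<omega>. of_nat (Zs 0 \<omega>) \<partial>M)"
    by (simp add: nn_integral_nat_function)
  finally show ?thesis .
qed

lemma average_low_additions:
  assumes f: "0 \<le> f" "f \<le> 1" and int: "integrable M (\<lambda>\<omega>. real (Zs 0 \<omega>))"
  shows "AE \<omega> in M. (\<lambda>n. (\<Sum>i<n. if C i \<omega> then real (card {k. k < Zs i \<omega> \<and> U i k \<omega> \<le> f}) else 0) / real n)
    \<longlonglongrightarrow> p * f * expectation (\<lambda>\<omega>. real (Zs 0 \<omega>))"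
proof -
  let ?G = "\<lambda>r :: nat \<Rightarrow> real. of_bool (r 2 = 1) * real (card {k. real k < r 1 \<and> r (3 + k) \<le> f})"
  let ?D = "\<lambda>i \<omega>. if C i \<omega> then real (card {k. k < Zs i \<omega> \<and> U i k \<omega> \<le> f}) else 0"
  have G: "?G (row i \<omega>) = ?D i \<omega>" for i \<omega>
    by (simp add: row_def numeral_2_eq_2 numeral_3_eq_3)
  have meas: "?G \<in> borel_measurable (PiM UNIV (\<lambda>_. borel :: real measure))"
    by measurable
  have [measurable]: "?D 0 \<in> borel_measurable M" by measurable
  have intD: "integrable M (?D 0)"
  proof (rule Bochner_Integration.integrable_bound[OF int])
    have "card {k. k < Zs 0 \<omega> \<and> U 0 k \<omega> \<le> f} \<le> Zs 0 \<omega>" for \<omega>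
      using card_mono[of "{..<Zs 0 \<omega>}" "{k. k < Zs 0 \<omega> \<and> U 0 k \<omega> \<le> f}"] by auto
    then show "AE \<omega> in M. norm (?D 0 \<omega>) \<le> norm (real (Zs 0 \<omega>))" by (auto intro!: AE_I2)
  qed simp
  have "ennreal (expectation (?D 0)) = (\<integral>\<^sup>+\<omega>. ennreal (?D 0 \<omega>) \<partial>M)"
    using intD by (subst nn_integral_eq_integral) auto
  also have "\<dots> = (\<integral>\<^sup>+\<omega>. of_nat (if C 0 \<omega> then card {k. k < Zs 0 \<omega> \<and> U 0 k \<omega> \<le> f} else 0) \<partial>M)"
    by (intro nn_integral_cong) (auto simp: ennreal_of_nat_eq_real_of_nat)
  also have "\<dots> = ennreal (p * f) * (\<integral>\<^sup>+\<omega>. ennreal (real (Zs 0 \<omega>)) \<partial>M)"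
    using nn_integral_low_additions[OF f] by (simp add: ennreal_of_nat_eq_real_of_nat)
  also have "\<dots> = ennreal (p * f) * ennreal (expectation (\<lambda>\<omega>. real (Zs 0 \<omega>)))"
    using int by (subst nn_integral_eq_integral) auto
  also have "\<dots> = ennreal (p * f * expectation (\<lambda>\<omega>. real (Zs 0 \<omega>)))"
    using p f by (intro ennreal_mult[symmetric]) auto
  finally have "expectation (?D 0) = p * f * expectation (\<lambda>\<omega>. real (Zs 0 \<omega>))"
    using p f by (subst (asm) ennreal_inj) (auto intro!: integral_nonneg_AE)
  then show ?thesis
    using row_law_of_large_numbers[OF meas] intD by (simp only: G)
qed

lemma AE_fitness_distinct: "AE \<omega> in M. inj (\<lambda>v. U (fst v) (snd v) \<omega>)"
proof -
  have *: "AE \<omega> in M. U (fst v) (snd v) \<omega> \<noteq> U (fst w) (snd w) \<omega>" if "v \<noteq> w" for v w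
  proof -
    let ?u = "uniform_measure lborel {0..1::real}"
    let ?V = "U (fst v) (snd v)" and ?W = "U (fst w) (snd w)"
    interpret u: prob_space ?u by (rule prob_space_uniform_measure) auto
    interpret uu: pair_prob_space ?u ?u ..
    have "indep_var borel ?V borel ?W"
      using indep_var_W[of "IU (fst v) (snd v)" "IU (fst w) (snd w)"] that by (auto simp: prod_eq_iff)
    then have d: "distr M (borel \<Otimes>\<^sub>M borel) (\<lambda>\<omega>. (?V \<omega>, ?W \<omega>)) = ?u \<Otimes>\<^sub>M ?u"
      unfolding indep_var_distribution_eq Uunif by simp
    have "AE x in ?u \<Otimes>\<^sub>M ?u. fst x \<noteq> snd x"
    proof (rule uu.AE_pair_measure)
      have "AE y in ?u. x \<noteq> y" for x
        using AE_lborel_singleton[of x] by (intro AE_uniform_measureI) (auto elim: AE_mp)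
      then show "AE x in ?u. AE y in ?u. fst (x, y) \<noteq> snd (x, y)" by simp
      have "{x \<in> space (borel \<Otimes>\<^sub>M borel). fst x \<noteq> (snd x :: real)} \<in> sets (borel \<Otimes>\<^sub>M borel)" by measurable
      then show "{x \<in> space (?u \<Otimes>\<^sub>M ?u). fst x \<noteq> snd x} \<in> sets (?u \<Otimes>\<^sub>M ?u)"
        by (simp add: space_pair_measure cong: sets_pair_measure_cong)
    qed
    then have "AE x in distr M (borel \<Otimes>\<^sub>M borel) (\<lambda>\<omega>. (?V \<omega>, ?W \<omega>)). fst x \<noteq> snd x" unfolding d .
    then show ?thesis by (subst (asm) AE_distr_iff) auto
  qed
  have "AE \<omega> in M. \<forall>v w. v \<noteq> w \<longrightarrow> U (fst v) (snd v) \<omega> \<noteq> U (fst w) (snd w) \<omega>"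
    unfolding AE_all_countable
  proof (intro allI)
    fix v w :: "nat \<times> nat"
    show "AE \<omega> in M. v \<noteq> w \<longrightarrow> U (fst v) (snd v) \<omega> \<noteq> U (fst w) (snd w) \<omega>"
      using * by (cases "v = w") auto
  qed
  then show ?thesis by eventually_elim (rule injI, blast)
qed

end

section \<open>Asymptotics of the evolution\<close>

lemma sublinear_increments:
  fixes S L :: "nat \<Rightarrow> real"
  assumes S: "(\<lambda>n. S n / real n) \<longlonglongrightarrow> 0"
    and L: "\<And>n. \<exists>m\<le>n. L n = S n - S m"
  shows "(\<lambda>n. L n / real n) \<longlonglongrightarrow> 0"
proof (rule LIMSEQ_I)
  fix r :: real assume r: "0 < r"
  then obtain n0 where n0: "\<And>n. n \<ge> n0 \<Longrightarrow> \<bar>S n / real n\<bar> < r / 4"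
    using LIMSEQ_D[OF S, of "r / 4"] by auto
  define K where "K = \<bar>S 0\<bar> + (\<Sum>m<n0. \<bar>S m\<bar>)"
  have K0: "0 \<le> K" unfolding K_def by (simp add: sum_nonneg)
  have bound: "\<bar>S m\<bar> \<le> K + r / 4 * real n" if "m \<le> n" for m n
  proof (cases "m < n0")
    case True
    then have "\<bar>S m\<bar> \<le> (\<Sum>m<n0. \<bar>S m\<bar>)" by (intro member_le_sum) auto
    moreover have "0 \<le> r / 4 * real n" using r by simp
    ultimately show ?thesis unfolding K_def by linarith
  next
    case False
    show ?thesis
    proof (cases "m = 0")
      case True
      moreover have "0 \<le> r / 4 * real n" using r by simp
      moreover have "0 \<le> (\<Sum>m<n0. \<bar>S m\<bar>)" by (simp add: sum_nonneg)
      ultimately show ?thesis unfolding K_def by simp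
    next
      case m: False
      have "\<bar>S m\<bar> \<le> r / 4 * real m" using n0[of m] False m by (simp add: abs_divide field_simps)
      also have "\<dots> \<le> r / 4 * real n" using r that by (intro mult_left_mono) auto
      finally show ?thesis using K0 by linarith
    qed
  qed
  obtain n1 :: nat where n1: "4 * K / r < real n1" using reals_Archimedean2 by blast
  have "\<bar>L n / real n - 0\<bar> < r" if "n \<ge> Suc n1" for n
  proof -
    obtain m where m: "m \<le> n" "L n = S n - S m" using L by blast
    have n: "real n > 0" "real n > real n1" using that by auto
    have "4 * K < r * real n1" using n1 r by (simp add: field_simps)
    also have "\<dots> \<le> r * real n" using n r by simp
    finally have "4 * K < r * real n" .
    moreover have "\<bar>L n\<bar> \<le> 2 * K + (r * real n) / 2"
      using bound[OF m(1)] bound[OF order_refl, of n] m(2) by simp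
    ultimately have "\<bar>L n\<bar> < r * real n" by linarith
    then show ?thesis using n by (simp add: abs_divide field_simps)
  qed
  then show "\<exists>no. \<forall>n\<ge>no. norm (L n / real n - 0) < r" by (auto intro!: exI[of _ "Suc n1"])
qed

lemma at_top_of_average:
  fixes N :: "nat \<Rightarrow> nat"
  assumes "c > 0" "eventually (\<lambda>n. c \<le> real (N n) / real n) sequentially"
  shows "filterlim N at_top sequentially"
proof -
  have "filterlim (\<lambda>n. real (N n)) at_top sequentially"
  proof (rule filterlim_at_top_mono)
    show "filterlim (\<lambda>n. c * real n) at_top sequentially"
      by (rule filterlim_tendsto_pos_mult_at_top[OF tendsto_const assms(1) filterlim_real_sequentially])
    show "\<forall>\<^sub>F n in sequentially. c * real n \<le> real (N n)"
      using assms(2) eventually_gt_at_top[of 0] by eventually_elim (simp add: field_simps)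
  qed
  then show ?thesis by (simp add: filterlim_sequentially_iff_filterlim_real)
qed

lemma (in prob_space) truncated_mean_unbounded:
  fixes V :: "'a \<Rightarrow> nat"
  assumes V [measurable]: "V \<in> measurable M (count_space UNIV)" and inf: "nn_mean M V = \<infinity>"
  shows "\<exists>k. c < expectation (\<lambda>\<omega>. real (min (V \<omega>) k))"
proof (rule ccontr)
  assume "\<not> ?thesis"
  then have le: "expectation (\<lambda>\<omega>. real (min (V \<omega>) k)) \<le> c" for k by (simp add: not_less)
  have "nn_mean M V = (\<integral>\<^sup>+\<omega>. (SUP k. ennreal (real (min (V \<omega>) k))) \<partial>M)"
    unfolding nn_mean_def
  proof (rule nn_integral_cong, rule antisym)
    fix \<omega>
    show "ennreal (real (V \<omega>)) \<le> (SUP k. ennreal (real (min (V \<omega>) k)))"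
      by (rule SUP_upper2[of "V \<omega>"]) auto
    show "(SUP k. ennreal (real (min (V \<omega>) k))) \<le> ennreal (real (V \<omega>))"
      by (rule SUP_least) (auto intro!: ennreal_leI)
  qed
  also have "\<dots> = (SUP k. \<integral>\<^sup>+\<omega>. ennreal (real (min (V \<omega>) k)) \<partial>M)"
    by (rule nn_integral_monotone_convergence_SUP)
       (auto simp: incseq_def le_fun_def intro!: ennreal_leI)
  also have "\<dots> \<le> ennreal c"
  proof (rule SUP_least)
    fix k
    have "integrable M (\<lambda>\<omega>. real (min (V \<omega>) k))"
      by (rule integrable_const_bound[of _ "real k"]) auto
    then have "(\<integral>\<^sup>+\<omega>. ennreal (real (min (V \<omega>) k)) \<partial>M) = ennreal (expectation (\<lambda>\<omega>. real (min (V \<omega>) k)))"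
      by (intro nn_integral_eq_integral) auto
    also have "\<dots> \<le> ennreal c" using le by (rule ennreal_leI)
    finally show "(\<integral>\<^sup>+\<omega>. ennreal (real (min (V \<omega>) k)) \<partial>M) \<le> ennreal c" .
  qed
  finally show False using inf by (simp add: top_unique)
qed

lemma (in prob_space) integrable_nn_mean:
  assumes V [measurable]: "V \<in> measurable M (count_space UNIV)" and fin: "nn_mean M V < \<infinity>"
  shows "integrable M (\<lambda>\<omega>. real (V \<omega>))" "expectation (\<lambda>\<omega>. real (V \<omega>)) = enn2real (nn_mean M V)"
  using fin unfolding nn_mean_def
  by (auto simp: integrable_iff_bounded integral_eq_nn_integral)

context evolution_model
begin

abbreviation evolved :: "nat \<Rightarrow> 'a \<Rightarrow> (nat \<times> nat) set" where
  "evolved n \<omega> \<equiv> evol (\<lambda>m. C m \<omega>) (\<lambda>m. Zs m \<omega>) (\<lambda>m. Xs m \<omega>) (\<lambda>m k. U m k \<omega>) n"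

definition low_count :: "real \<Rightarrow> nat \<Rightarrow> 'a \<Rightarrow> real" where
  "low_count f n \<omega> = real (card {v \<in> evolved n \<omega>. U (fst v) (snd v) \<omega> \<le> f})"

definition low_walk :: "real \<Rightarrow> nat \<Rightarrow> 'a \<Rightarrow> real" where
  "low_walk f n \<omega> = (\<Sum>m<n. if C m \<omega> then real (card {k. k < Zs m \<omega> \<and> U m k \<omega> \<le> f}) else - real (Xs m \<omega>))"

definition high_count :: "real \<Rightarrow> nat \<Rightarrow> 'a \<Rightarrow> nat" where
  "high_count f n \<omega> = (\<Sum>m<n. if C m \<omega> then card {k. k < Zs m \<omega> \<and> f < U m k \<omega>} else 0)"

lemma measurable_high_count [measurable]: "high_count f n \<in> measurable M (count_space UNIV)"
  unfolding high_count_def by measurable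

lemma sel_W: "sel {} f (\<lambda>j. W j \<omega>)
    = {v \<in> added (\<lambda>m. C m \<omega>) (\<lambda>m. Zs m \<omega>). f < U (fst v) (snd v) \<omega>}"
  by (auto simp: sel_def added_def split: if_splits)

lemma card_sel_W: "card {v \<in> sel {} f (\<lambda>j. W j \<omega>). fst v < n} = high_count f n \<omega>"
proof -
  have "{v \<in> sel {} f (\<lambda>j. W j \<omega>). fst v < n}
      = {v \<in> added (\<lambda>m. C m \<omega>) (\<lambda>m. Zs m \<omega>). fst v < n \<and> f < U (fst v) (snd v) \<omega>}"
    unfolding sel_W by auto
  then show ?thesis
    unfolding high_count_def
    using card_added[of "\<lambda>m. C m \<omega>" "\<lambda>m. Zs m \<omega>" n "\<lambda>a. f < a" "\<lambda>m k. U m k \<omega>"] by simp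
qed

lemma low_count_eq_increment: "\<exists>m\<le>n. low_count f n \<omega> = low_walk f n \<omega> - low_walk f m \<omega>"
  unfolding low_count_def low_walk_def
  by (rule reflected_walk_eq_increment[of
        "\<lambda>n. card {v \<in> evolved n \<omega>. U (fst v) (snd v) \<omega> \<le> f}" "\<lambda>m. C m \<omega>"])
     (simp, rule card_evol_lower_Suc[of "\<lambda>a. a \<le> f"], simp)

lemma approaches_uniform:
  assumes f: "0 \<le> f" "f < 1"
    and lim: "AE \<omega> in M. filterlim (\<lambda>n. high_count f n \<omega>) at_top sequentially"
    and small: "AE \<omega> in M. (\<lambda>n. (2 * low_count f n \<omega> - low_walk f n \<omega>) / real (high_count f n \<omega>)) \<longlonglongrightarrow> 0"
  shows "approaches_sample M (\<lambda>n \<omega>. fitset (\<lambda>m. C m \<omega>) (\<lambda>m. Zs m \<omega>) (\<lambda>m. Xs m \<omega>) (\<lambda>m k. U m k \<omega>) n)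
    (uniform_measure lborel {f..1})"
proof -
  define Y where "Y i \<omega> = nth_fitness f i (\<lambda>j. W j \<omega>)" for i \<omega>
  have rank: "bij_betw (lex_rank (sel {} f (\<lambda>j. W j \<omega>))) {v \<in> sel {} f (\<lambda>j. W j \<omega>). fst v < n} {..<high_count f n \<omega>}"
    for n \<omega>
    using lex_rank_segment_bij[OF finite_sel_segment[of "{}" f "\<lambda>j. W j \<omega>" n]] unfolding card_sel_W .
  have nth: "\<exists>v. v \<in> sel {} f (\<lambda>j. W j \<omega>) \<and> fst v < n \<and> sel_index f i (\<lambda>j. W j \<omega>) = Some v"
    if "i < high_count f n \<omega>" for i n \<omega>
  proof -
    have "i \<in> lex_rank (sel {} f (\<lambda>j. W j \<omega>)) ` {v \<in> sel {} f (\<lambda>j. W j \<omega>). fst v < n}"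
      using that bij_betw_imp_surj_on[OF rank[of \<omega> n]] by simp
    then show ?thesis unfolding sel_index_eq_Some_iff by blast
  qed
  have ex: "AE \<omega> in M. \<forall>i. sel_index f i (\<lambda>j. W j \<omega>) \<noteq> None"
    using lim
  proof eventually_elim
    case (elim \<omega>)
    show ?case
    proof
      fix i
      have "eventually (\<lambda>n. Suc i \<le> high_count f n \<omega>) sequentially"
        using elim unfolding filterlim_at_top by blast
      then obtain n where "Suc i \<le> high_count f n \<omega>" by (auto simp: eventually_sequentially)
      then show "sel_index f i (\<lambda>j. W j \<omega>) \<noteq> None" using nth[of i n \<omega>] by auto
    qed
  qed
  have "distr M borel (W (IU n k)) = uniform_measure lborel {0..1}" for n k
    using Uunif by simp
  note iid = selected_fitness_iid[OF indep_W this f ex]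
  have AE: "AE \<omega> in M. mono (\<lambda>n. high_count f n \<omega>) \<and>
      filterlim (\<lambda>n. card {Y i \<omega> | i. i < high_count f n \<omega>}) at_top sequentially \<and>
      (\<lambda>n. real (card ((fitset (\<lambda>m. C m \<omega>) (\<lambda>m. Zs m \<omega>) (\<lambda>m. Xs m \<omega>) (\<lambda>m k. U m k \<omega>) n - {Y i \<omega> | i. i < high_count f n \<omega>})
          \<union> ({Y i \<omega> | i. i < high_count f n \<omega>} - fitset (\<lambda>m. C m \<omega>) (\<lambda>m. Zs m \<omega>) (\<lambda>m. Xs m \<omega>) (\<lambda>m k. U m k \<omega>) n))))
        \<in> o(\<lambda>n. real (card {Y i \<omega> | i. i < high_count f n \<omega>}))"
    using lim small AE_fitness_distinct
  proof eventually_elim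
    case (elim \<omega>)
    define g where "g v = U (fst v) (snd v) \<omega>" for v
    define S where "S = sel {} f (\<lambda>j. W j \<omega>)"
    have sample: "{Y i \<omega> | i. i < high_count f n \<omega>} = g ` {v \<in> S. fst v < n}" for n
    proof (intro set_eqI iffI)
      fix y assume "y \<in> {Y i \<omega> | i. i < high_count f n \<omega>}"
      then obtain i where i: "i < high_count f n \<omega>" "y = Y i \<omega>" by blast
      then obtain v where "v \<in> S" "fst v < n" "sel_index f i (\<lambda>j. W j \<omega>) = Some v"
        using nth unfolding S_def by blast
      then show "y \<in> g ` {v \<in> S. fst v < n}" using i by (auto simp: Y_def nth_fitness_def g_def)
    next
      fix y assume "y \<in> g ` {v \<in> S. fst v < n}"
      then obtain v where v: "v \<in> S" "fst v < n" "y = g v" by blast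
      then have "lex_rank S v < high_count f n \<omega>"
        using bij_betw_apply[OF rank[of \<omega> n], of v] unfolding S_def by simp
      moreover have "sel_index f (lex_rank S v) (\<lambda>j. W j \<omega>) = Some v"
        unfolding sel_index_eq_Some_iff using v S_def by simp
      then have "Y (lex_rank S v) \<omega> = y" using v by (simp add: Y_def nth_fitness_def g_def)
      ultimately show "y \<in> {Y i \<omega> | i. i < high_count f n \<omega>}" by blast
    qed
    have "inj g" using elim(3) unfolding g_def .
    then have card: "card (g ` {v \<in> S. fst v < n}) = high_count f n \<omega>" for n
      using card_image[of g "{v \<in> S. fst v < n}"] card_sel_W[of f \<omega> n] inj_on_subset[of g UNIV]
      unfolding S_def by auto
    have mono: "mono (\<lambda>n. high_count f n \<omega>)"
    proof (rule monoI)
      fix m n :: nat assume "m \<le> n"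
      then show "high_count f m \<omega> \<le> high_count f n \<omega>"
        unfolding card_sel_W[symmetric] by (intro card_mono finite_sel_segment) auto
    qed
    let ?A = "\<lambda>n. fitset (\<lambda>m. C m \<omega>) (\<lambda>m. Zs m \<omega>) (\<lambda>m. Xs m \<omega>) (\<lambda>m k. U m k \<omega>) n"
    let ?D = "\<lambda>n. real (card ((?A n - g ` {v \<in> S. fst v < n}) \<union> (g ` {v \<in> S. fst v < n} - ?A n)))"
    have D: "?D n \<le> 2 * low_count f n \<omega> - low_walk f n \<omega>" for n
    proof -
      have "{v \<in> S. fst v < n} = {v \<in> added (\<lambda>m. C m \<omega>) (\<lambda>m. Zs m \<omega>). fst v < n \<and> f < U (fst v) (snd v) \<omega>}"
        unfolding S_def sel_W by auto
      then show ?thesis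
        using card_sym_diff_evol[of "\<lambda>m k. U m k \<omega>" "\<lambda>m. C m \<omega>" "\<lambda>m. Zs m \<omega>" "\<lambda>m. Xs m \<omega>" n f]
        unfolding fitset_def low_count_def low_walk_def g_def by simp
    qed
    have pos: "eventually (\<lambda>n. 1 \<le> high_count f n \<omega>) sequentially"
      using elim(1) unfolding filterlim_at_top by blast
    have "?D \<in> o(\<lambda>n. real (high_count f n \<omega>))"
    proof (rule smalloI_tendsto)
      show "(\<lambda>n. ?D n / real (high_count f n \<omega>)) \<longlonglongrightarrow> 0"
      proof (rule tendsto_sandwich[OF _ _ tendsto_const elim(2)])
        show "\<forall>\<^sub>F n in sequentially. 0 \<le> ?D n / real (high_count f n \<omega>)" by simp
        show "\<forall>\<^sub>F n in sequentially. ?D n / real (high_count f n \<omega>)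
            \<le> (2 * low_count f n \<omega> - low_walk f n \<omega>) / real (high_count f n \<omega>)"
          using D by (intro always_eventually allI divide_right_mono) auto
      qed
      show "\<forall>\<^sub>F n in sequentially. real (high_count f n \<omega>) \<noteq> 0"
        using pos by eventually_elim auto
    qed
    with mono elim(1) show ?case unfolding sample card by simp
  qed
  show ?thesis
    unfolding approaches_sample_def
  proof (intro exI conjI allI)
    show "indep_vars (\<lambda>_. borel) Y UNIV" using iid(1) unfolding Y_def .
    show "distr M borel (Y i) = uniform_measure lborel {f..1}" for i
      using iid(2) unfolding Y_def .
  qed (use AE in auto)
qed

lemma high_count_eq:
  "real (high_count f n \<omega>) = (\<Sum>i<n. if C i \<omega> then real (Zs i \<omega>) else 0)
    - (\<Sum>i<n. if C i \<omega> then real (card {k. k < Zs i \<omega> \<and> U i k \<omega> \<le> f}) else 0)"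
proof -
  have "card {k. k < Zs i \<omega> \<and> U i k \<omega> \<le> f} + card {k. k < Zs i \<omega> \<and> f < U i k \<omega>} = Zs i \<omega>" for i
  proof -
    have "card ({k. k < Zs i \<omega> \<and> U i k \<omega> \<le> f} \<union> {k. k < Zs i \<omega> \<and> f < U i k \<omega>})
        = card {k. k < Zs i \<omega> \<and> U i k \<omega> \<le> f} + card {k. k < Zs i \<omega> \<and> f < U i k \<omega>}"
      by (rule card_Un_disjoint) auto
    moreover have "{k. k < Zs i \<omega> \<and> U i k \<omega> \<le> f} \<union> {k. k < Zs i \<omega> \<and> f < U i k \<omega>} = {..<Zs i \<omega>}" by auto
    ultimately show ?thesis by simp
  qed
  then have "real (card {k. k < Zs i \<omega> \<and> U i k \<omega> \<le> f} + card {k. k < Zs i \<omega> \<and> f < U i k \<omega>}) = real (Zs i \<omega>)" for i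
    by (rule arg_cong)
  then have "real (card {k. k < Zs i \<omega> \<and> f < U i k \<omega>}) = real (Zs i \<omega>) - real (card {k. k < Zs i \<omega> \<and> U i k \<omega> \<le> f})" for i
    unfolding of_nat_add by (simp add: eq_diff_eq add.commute)
  then show ?thesis
    unfolding high_count_def sum_subtractf[symmetric] of_nat_sum
    by (intro sum.cong) auto
qed

lemma low_walk_eq:
  "low_walk f n \<omega> = (\<Sum>i<n. if C i \<omega> then real (card {k. k < Zs i \<omega> \<and> U i k \<omega> \<le> f}) else 0)
    - (\<Sum>i<n. if C i \<omega> then 0 else real (Xs i \<omega>))"
  unfolding low_walk_def sum_subtractf[symmetric] by (intro sum.cong) auto

lemma approaches_uniform_supercritical:
  assumes intX: "integrable M (\<lambda>\<omega>. real (Xs 0 \<omega>))" and intZ: "integrable M (\<lambda>\<omega>. real (Zs 0 \<omega>))"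
    and f: "0 \<le> f" "f < 1"
    and balance: "p * f * expectation (\<lambda>\<omega>. real (Zs 0 \<omega>)) = (1 - p) * expectation (\<lambda>\<omega>. real (Xs 0 \<omega>))"
    and pos: "0 < expectation (\<lambda>\<omega>. real (Zs 0 \<omega>))"
  shows "approaches_sample M (\<lambda>n \<omega>. fitset (\<lambda>m. C m \<omega>) (\<lambda>m. Zs m \<omega>) (\<lambda>m. Xs m \<omega>) (\<lambda>m k. U m k \<omega>) n)
    (uniform_measure lborel {f..1})"
proof -
  let ?z = "expectation (\<lambda>\<omega>. real (Zs 0 \<omega>))"
  define d where "d = p * ?z - p * f * ?z"
  have "d = p * (1 - f) * ?z" by (simp add: d_def algebra_simps)
  then have d: "0 < d" using p f pos by simp
  have avgs: "AE \<omega> in M. (\<lambda>n. real (high_count f n \<omega>) / real n) \<longlonglongrightarrow> d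
      \<and> (\<lambda>n. low_walk f n \<omega> / real n) \<longlonglongrightarrow> 0"
    using average_additions[OF intZ] average_removals[OF intX] average_low_additions[OF f(1) less_imp_le[OF f(2)] intZ]
  proof eventually_elim
    case (elim \<omega>)
    show ?case
      using tendsto_diff[OF elim(1,3)] tendsto_diff[OF elim(3,2)]
      by (simp add: high_count_eq low_walk_eq diff_divide_distrib balance d_def)
  qed
  show ?thesis
  proof (rule approaches_uniform[OF f])
    show "AE \<omega> in M. filterlim (\<lambda>n. high_count f n \<omega>) at_top sequentially"
      using avgs
    proof eventually_elim
      case (elim \<omega>)
      have "d / 2 < d" using d by linarith
      then have "eventually (\<lambda>n. d / 2 < real (high_count f n \<omega>) / real n) sequentially"
        using elim by (intro order_tendstoD(1)[where y = d]) blast+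
      then show ?case
        using d by (intro at_top_of_average[of "d / 2"]) (auto elim: eventually_mono)
    qed
    show "AE \<omega> in M. (\<lambda>n. (2 * low_count f n \<omega> - low_walk f n \<omega>) / real (high_count f n \<omega>)) \<longlonglongrightarrow> 0"
      using avgs
    proof eventually_elim
      case (elim \<omega>)
      have "(\<lambda>n. low_count f n \<omega> / real n) \<longlonglongrightarrow> 0"
        by (rule sublinear_increments[OF conjunct2[OF elim] low_count_eq_increment])
      then have "(\<lambda>n. (2 * (low_count f n \<omega> / real n) - low_walk f n \<omega> / real n) / (real (high_count f n \<omega>) / real n))
          \<longlonglongrightarrow> (2 * 0 - 0) / d"
        using elim d by (intro tendsto_intros) auto
      moreover have "eventually (\<lambda>n. (2 * (low_count f n \<omega> / real n) - low_walk f n \<omega> / real n) / (real (high_count f n \<omega>) / real n)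
          = (2 * low_count f n \<omega> - low_walk f n \<omega>) / real (high_count f n \<omega>)) sequentially"
        using eventually_gt_at_top[of 0]
        by eventually_elim (simp add: diff_divide_distrib[symmetric])
      ultimately have "(\<lambda>n. (2 * low_count f n \<omega> - low_walk f n \<omega>) / real (high_count f n \<omega>)) \<longlonglongrightarrow> (2 * 0 - 0) / d"
        by (rule Lim_transform_eventually)
      then show ?case by simp
    qed
  qed
qed

lemma approaches_uniform_infinite_mean:
  assumes intX: "integrable M (\<lambda>\<omega>. real (Xs 0 \<omega>))" and infZ: "nn_mean M (Zs 0) = \<infinity>"
  shows "approaches_sample M (\<lambda>n \<omega>. fitset (\<lambda>m. C m \<omega>) (\<lambda>m. Zs m \<omega>) (\<lambda>m. Xs m \<omega>) (\<lambda>m k. U m k \<omega>) n)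
    (uniform_measure lborel {0..1})"
proof -
  have "AE \<omega> in M. \<forall>m k. 0 < U m k \<omega>"
  proof -
    have "AE \<omega> in M. 0 < U m k \<omega>" for m k
    proof -
      have "prob {\<omega> \<in> space M. U m k \<omega> \<le> 0} = 0" by (rule prob_fitness_le) auto
      then have "AE \<omega> in M. \<not> U m k \<omega> \<le> 0" by (subst (asm) prob_Collect_eq_0) auto
      then show ?thesis by (rule AE_mp) auto
    qed
    then show ?thesis by (simp add: AE_all_countable)
  qed
  moreover have "AE \<omega> in M. \<forall>k. (\<lambda>n. (\<Sum>i<n. if C i \<omega> then real (min (Zs i \<omega>) k) else 0) / real n)
      \<longlonglongrightarrow> p * expectation (\<lambda>\<omega>. real (min (Zs 0 \<omega>) k))"
    unfolding AE_all_countable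
  proof
    fix k
    have "integrable M (\<lambda>\<omega>. real (min (Zs 0 \<omega>) k))"
      by (rule integrable_const_bound[of _ "real k"]) auto
    then show "AE \<omega> in M. (\<lambda>n. (\<Sum>i<n. if C i \<omega> then real (min (Zs i \<omega>) k) else 0) / real n)
      \<longlonglongrightarrow> p * expectation (\<lambda>\<omega>. real (min (Zs 0 \<omega>) k))"
      by (rule average_additions)
  qed
  moreover note average_removals[OF intX]
  ultimately have facts: "AE \<omega> in M. (\<forall>n. low_count 0 n \<omega> = 0) \<and>
      filterlim (\<lambda>n. real (high_count 0 n \<omega>) / real n) at_top sequentially \<and>
      (\<exists>r. (\<lambda>n. low_walk 0 n \<omega> / real n) \<longlonglongrightarrow> r)"
  proof eventually_elim
    case (elim \<omega>)
    have none: "{k. k < Zs i \<omega> \<and> U i k \<omega> \<le> 0} = {}" for i using elim(1) by (auto simp: not_le)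
    have "low_count 0 n \<omega> = 0" for n
      unfolding low_count_def using elim(1) by (auto simp: not_le[symmetric] intro!: card_eq_0_iff[THEN iffD2])
    moreover have "filterlim (\<lambda>n. real (high_count 0 n \<omega>) / real n) at_top sequentially"
      unfolding filterlim_at_top
    proof
      fix c :: real
      obtain k where "c / p < expectation (\<lambda>\<omega>. real (min (Zs 0 \<omega>) k))"
        using truncated_mean_unbounded[OF Zmeas infZ] by blast
      then have "c < p * expectation (\<lambda>\<omega>. real (min (Zs 0 \<omega>) k))"
        using p by (simp add: field_simps)
      then have "eventually (\<lambda>n. c < (\<Sum>i<n. if C i \<omega> then real (min (Zs i \<omega>) k) else 0) / real n) sequentially"
        using elim(2) by (intro order_tendstoD(1)) auto
      then show "eventually (\<lambda>n. c \<le> real (high_count 0 n \<omega>) / real n) sequentially"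
      proof eventually_elim
        case (elim n)
        have "(\<Sum>i<n. if C i \<omega> then real (min (Zs i \<omega>) k) else 0)
            \<le> (\<Sum>i<n. if C i \<omega> then real (Zs i \<omega>) else 0)"
          by (intro sum_mono) auto
        then have "(\<Sum>i<n. if C i \<omega> then real (min (Zs i \<omega>) k) else 0) \<le> real (high_count 0 n \<omega>)"
          unfolding high_count_eq none
          by (simp only: card.empty of_nat_0 if_cancel sum.neutral_const diff_zero)
        then have "(\<Sum>i<n. if C i \<omega> then real (min (Zs i \<omega>) k) else 0) / real n \<le> real (high_count 0 n \<omega>) / real n"
          by (rule divide_right_mono) simp
        with elim show ?case by linarith
      qed
    qed
    moreover have "(\<lambda>n. low_walk 0 n \<omega> / real n) \<longlonglongrightarrow> - ((1 - p) * expectation (\<lambda>\<omega>. real (Xs 0 \<omega>)))"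
      using tendsto_minus[OF elim(3)] unfolding low_walk_eq none
      by (simp only: card.empty of_nat_0 if_cancel sum.neutral_const diff_0 minus_divide_left)
    ultimately show ?case by blast
  qed
  show ?thesis
  proof (rule approaches_uniform)
    show "AE \<omega> in M. filterlim (\<lambda>n. high_count 0 n \<omega>) at_top sequentially"
      using facts
      by eventually_elim (rule at_top_of_average[of 1], auto simp: filterlim_at_top)
    show "AE \<omega> in M. (\<lambda>n. (2 * low_count 0 n \<omega> - low_walk 0 n \<omega>) / real (high_count 0 n \<omega>)) \<longlonglongrightarrow> 0"
      using facts
    proof eventually_elim
      case (elim \<omega>)
      then obtain r where r: "(\<lambda>n. low_walk 0 n \<omega> / real n) \<longlonglongrightarrow> r" by blast
      have "(\<lambda>n. - (low_walk 0 n \<omega> / real n) / (real (high_count 0 n \<omega>) / real n)) \<longlonglongrightarrow> 0"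
        using elim by (intro tendsto_divide_0[OF tendsto_minus[OF r]] filterlim_at_top_imp_at_infinity) auto
      moreover have "eventually (\<lambda>n. - (low_walk 0 n \<omega> / real n) / (real (high_count 0 n \<omega>) / real n)
          = (2 * low_count 0 n \<omega> - low_walk 0 n \<omega>) / real (high_count 0 n \<omega>)) sequentially"
        using eventually_gt_at_top[of 0] by eventually_elim (use elim in simp)
      ultimately show ?case by (simp add: tendsto_cong)
    qed
  qed auto
qed

lemma empty_infinitely_often:
  fixes h :: "nat \<Rightarrow> real"
  assumes intX: "integrable M (\<lambda>\<omega>. h (Xs 0 \<omega>))" and le: "\<And>x. h x \<le> real x"
    and intZ: "integrable M (\<lambda>\<omega>. real (Zs 0 \<omega>))"
    and drift: "p * expectation (\<lambda>\<omega>. real (Zs 0 \<omega>)) < (1 - p) * expectation (\<lambda>\<omega>. h (Xs 0 \<omega>))"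
  shows "AE \<omega> in M. \<exists>\<^sub>\<infinity>n. evolved n \<omega> = {}"
  using average_additions[OF intZ] average_removals[OF intX]
proof eventually_elim
  case (elim \<omega>)
  let ?S = "\<lambda>n. \<Sum>i<n. if C i \<omega> then real (Zs i \<omega>) else - real (Xs i \<omega>)"
  let ?S' = "\<lambda>n. (\<Sum>i<n. if C i \<omega> then real (Zs i \<omega>) else 0) - (\<Sum>i<n. if C i \<omega> then 0 else h (Xs i \<omega>))"
  define e where "e = (1 - p) * expectation (\<lambda>\<omega>. h (Xs 0 \<omega>)) - p * expectation (\<lambda>\<omega>. real (Zs 0 \<omega>))"
  have e: "e > 0" using drift by (simp add: e_def)
  have "(\<lambda>n. ?S' n / real n) \<longlonglongrightarrow> - e"
    using tendsto_diff[OF elim] by (simp add: e_def diff_divide_distrib)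
  then have ev: "eventually (\<lambda>n. ?S' n / real n < - (e / 2)) sequentially"
    using e by (intro order_tendstoD(2)) auto
  have "filterlim ?S at_bot sequentially"
  proof (rule filterlim_at_bot_mono)
    show "filterlim (\<lambda>n. - (e / 2) * real n) at_bot sequentially"
      using e by (intro filterlim_tendsto_neg_mult_at_bot[OF tendsto_const _ filterlim_real_sequentially]) auto
    show "\<forall>\<^sub>F n in sequentially. ?S n \<le> - (e / 2) * real n"
      using ev eventually_gt_at_top[of 0]
    proof eventually_elim
      case (elim n)
      have "?S n \<le> ?S' n" unfolding sum_subtractf[symmetric] using le by (intro sum_mono) auto
      then show ?case using elim by (simp add: field_simps)
    qed
  qed
  then have "\<exists>\<^sub>\<infinity>n. card {v \<in> evolved n \<omega>. True} = 0"
  proof (rule reflected_walk_hits_zero[rotated 2])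
    show "card {v \<in> evolved (Suc n) \<omega>. True}
      = (if C n \<omega> then card {v \<in> evolved n \<omega>. True} + Zs n \<omega> else card {v \<in> evolved n \<omega>. True} - Xs n \<omega>)" for n
      using card_evol_lower_Suc[of "\<lambda>_. True" "\<lambda>m. C m \<omega>" "\<lambda>m. Zs m \<omega>" "\<lambda>m. Xs m \<omega>" "\<lambda>m k. U m k \<omega>" n] by simp
  qed simp
  then show ?case using finite_evol by (simp add: card_eq_0_iff)
qed

end

theorem theorem4:
  fixes M :: "'a measure"
    and Xs Zs :: "nat \<Rightarrow> 'a \<Rightarrow> nat"
    and C :: "nat \<Rightarrow> 'a \<Rightarrow> bool"
    and U :: "nat \<Rightarrow> nat \<Rightarrow> 'a \<Rightarrow> real"
    and p :: real
  assumes M: "prob_space M"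
    and p: "0 < p" "p < 1"
    and Xmeas: "\<And>n. Xs n \<in> measurable M (count_space UNIV)"
    and Zmeas: "\<And>n. Zs n \<in> measurable M (count_space UNIV)"
    and Cmeas: "\<And>n. C n \<in> measurable M (count_space UNIV)"
    and Xpos: "\<And>n \<omega>. \<omega> \<in> space M \<Longrightarrow> Xs n \<omega> \<ge> 1"
    and Zpos: "\<And>n \<omega>. \<omega> \<in> space M \<Longrightarrow> Zs n \<omega> \<ge> 1"
    and Xid: "\<And>n. distr M (count_space UNIV) (Xs n) = distr M (count_space UNIV) (Xs 0)"
    and Zid: "\<And>n. distr M (count_space UNIV) (Zs n) = distr M (count_space UNIV) (Zs 0)"
    and Cp: "\<And>n. measure M {\<omega> \<in> space M. C n \<omega>} = p"
    and Uunif: "\<And>n k. distr M borel (U n k) = uniform_measure lborel {0..1}"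
    and indep: "prob_space.indep_vars M (\<lambda>_. borel)
                  (\<lambda>i \<omega>. case i of IX n \<Rightarrow> real (Xs n \<omega>) | IZ n \<Rightarrow> real (Zs n \<omega>)
                                | IC n \<Rightarrow> (if C n \<omega> then 1 else 0) | IU n k \<Rightarrow> U n k \<omega>) UNIV"
  defines "T \<equiv> \<lambda>n \<omega>. evol (\<lambda>m. C m \<omega>) (\<lambda>m. Zs m \<omega>) (\<lambda>m. Xs m \<omega>) (\<lambda>m k. U m k \<omega>) n"
    and "A \<equiv> \<lambda>n \<omega>. fitset (\<lambda>m. C m \<omega>) (\<lambda>m. Zs m \<omega>) (\<lambda>m. Xs m \<omega>) (\<lambda>m k. U m k \<omega>) n"
    and "muX \<equiv> nn_mean M (Xs 0)"
    and "muZ \<equiv> nn_mean M (Zs 0)"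
  shows
    "(muZ = \<infinity> \<and> muX < \<infinity> \<longrightarrow>
        approaches_sample M A (uniform_measure lborel {0..1}))
   \<and> (muZ < \<infinity> \<and> muX < \<infinity> \<and> p > enn2real muX / (enn2real muX + enn2real muZ) \<longrightarrow>
        approaches_sample M A
          (uniform_measure lborel {(1 - p) / p * (enn2real muX / enn2real muZ)..1}))
   \<and> (muZ < \<infinity> \<and> ((muX < \<infinity> \<and> p < enn2real muX / (enn2real muX + enn2real muZ)) \<or> muX = \<infinity>) \<longrightarrow>
        (AE \<omega> in M. \<exists>\<^sub>\<infinity> n. T n \<omega> = {}))"
proof -
  interpret prob_space M by (rule M)
  interpret evolution_model M Xs Zs C U p
    by unfold_locales (fact p Xmeas Zmeas Cmeas Xid Zid Cp Uunif indep)+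
  note X = integrable_nn_mean[OF Xmeas, of 0, folded muX_def]
    and Z = integrable_nn_mean[OF Zmeas, of 0, folded muZ_def]
  show ?thesis
  proof (intro conjI impI)
    assume "muZ = \<infinity> \<and> muX < \<infinity>"
    then show "approaches_sample M A (uniform_measure lborel {0..1})"
      unfolding A_def by (intro approaches_uniform_infinite_mean X) (auto simp: muZ_def)
  next
    assume *: "muZ < \<infinity> \<and> muX < \<infinity> \<and> p > enn2real muX / (enn2real muX + enn2real muZ)"
    then have fin: "muZ < \<infinity>" "muX < \<infinity>" by auto
    let ?x = "enn2real muX" and ?z = "enn2real muZ"
    have "1 = expectation (\<lambda>_. 1 :: real)" using prob_space by simp
    also have "\<dots> \<le> expectation (\<lambda>\<omega>. real (Zs 0 \<omega>))"
      using Z(1)[OF fin(1)] Zpos by (intro integral_mono) auto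
    finally have z: "1 \<le> ?z" using Z(2)[OF fin(1)] by simp
    have x: "0 \<le> ?x" by simp
    have "(1 - p) * ?x < p * ?z" using * x z by (simp add: field_simps)
    then have "(1 - p) / p * (?x / ?z) < 1" using p z by (simp add: divide_less_eq mult.commute)
    moreover have "0 \<le> (1 - p) / p * (?x / ?z)" using p x z by simp
    moreover have "p * ((1 - p) / p * (?x / ?z)) * ?z = (1 - p) * ?x" using p z by simp
    ultimately show "approaches_sample M A (uniform_measure lborel {(1 - p) / p * (?x / ?z)..1})"
      unfolding A_def using z X[OF fin(2)] Z[OF fin(1)]
      by (intro approaches_uniform_supercritical) simp_all
  next
    assume *: "muZ < \<infinity> \<and> ((muX < \<infinity> \<and> p < enn2real muX / (enn2real muX + enn2real muZ)) \<or> muX = \<infinity>)"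
    then have fin: "muZ < \<infinity>" by auto
    show "AE \<omega> in M. \<exists>\<^sub>\<infinity> n. T n \<omega> = {}"
    proof (cases "muX = \<infinity>")
      case True
      then obtain k where k: "p * enn2real muZ / (1 - p) < expectation (\<lambda>\<omega>. real (min (Xs 0 \<omega>) k))"
        using truncated_mean_unbounded[OF Xmeas] unfolding muX_def by blast
      have "p * enn2real muZ < (1 - p) * expectation (\<lambda>\<omega>. real (min (Xs 0 \<omega>) k))"
        using k p by (simp add: field_simps)
      moreover have "integrable M (\<lambda>\<omega>. real (min (Xs 0 \<omega>) k))"
        using Xmeas by (intro integrable_const_bound[of _ "real k"]) auto
      ultimately show ?thesis
        unfolding T_def using Z[OF fin]
        by (intro empty_infinitely_often[of "\<lambda>x. real (min x k)"]) auto
    next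
      case False
      then have fin': "muX < \<infinity>" and lt: "p < enn2real muX / (enn2real muX + enn2real muZ)"
        using * by auto
      have "0 \<le> enn2real muX" "0 \<le> enn2real muZ" by auto
      moreover have "enn2real muX + enn2real muZ \<noteq> 0" using lt p by auto
      ultimately have "0 < enn2real muX + enn2real muZ" by linarith
      then have "p * enn2real muZ < (1 - p) * enn2real muX"
        using lt by (simp add: field_simps)
      then show ?thesis
        unfolding T_def using Z[OF fin] X[OF fin']
        by (intro empty_infinitely_often[of real]) auto
    qed
  qed
qed

end
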